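(* Let $\mathbb{G}$ be a totally ordered Abelian group with $\operatorname{Deg}(\mathbb{G})=\kappa$. For any space $X$ the following are equivalent: (a) $X$ is a $\kappa$-Lindelöf $\kappa$-additive space of weight $\le\kappa$; (b) $X$ is a $\kappa$-Lindelöf $\mathbb{G}$-metrizable space; (c) $X$ is a $\kappa$-Lindelöf $\mathbb{G}$-Polish space; (d) $X$ is a $\kappa$-Lindelöf $\kappa$-additive $f\mathrm{SC}_\kappa$-space. If $\kappa$ is weakly compact, conditions (a), (b), (c) and (d) are also equivalent to: (e) $X$ is homeomorphic to a closed subset of ${}^{\kappa}2$.
   Context: Work in ZFC; $\kappa$ is an uncountable regular cardinal with $2^{<\kappa}=\kappa$ (equivalently $\kappa^{<\kappa}=\kappa$). "Space" means regular Hausdorff topological space. $\kappa$ is weakly compact if it is strongly inaccessible and every tree $T\subseteq{}^{<\kappa}\kappa$ (set closed under initial segments) all of whose levels $T\cap{}^{\alpha}\kappa$, $\alpha<\kappa$, are nonempty and of size $<\kappa$ has a branch of length $\kappa$. ${}^{\kappa}2$ is the set of all functions $\kappa\to 2$ with the bounded topology, generated by the sets $\{x\in{}^{\kappa}2 \mid s\subseteq x\}$, $s\in{}^{<\kappa}2$. A space is $\kappa$-additive if its topology is closed under intersections of fewer than $\kappa$ open sets, and $\kappa$-Lindelöf if every open cover has a subcover of size $<\kappa$. Strong fair $\kappa$-Choquet game $f\mathrm{G}^s_\kappa(X)$: players I and II play $\kappa$-many rounds. In round $\alpha<\kappa$, I plays $(U_\alpha,x_\alpha)$ with $U_\alpha$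 a relatively open subset of $\bigcap_{\beta<\alpha}V_\beta$ (which is $X$ if $\alpha=0$) and $x_\alpha\in U_\alpha$; then II plays a relatively open subset $V_\alpha$ of $\bigcap_{\beta<\alpha}V_\beta$ with $x_\alpha\in V_\alpha\subseteq U_\alpha$. If $\bigcap_{\alpha<\gamma}V_\alpha=\emptyset$ for some limit $\gamma<\kappa$, the run ends and II wins. If the run lasts $\kappa$ rounds, II wins iff $\bigcap_{\alpha<\kappa}V_\alpha\neq\emptyset$. $X$ is an $f\mathrm{SC}_\kappa$-space if it has weight $\le\kappa$ and II has a winning strategy in $f\mathrm{G}^s_\kappa(X)$. (The empty space, where I has no legal move, counts as such.) For a totally ordered (with translation-invariant linear order) Abelian group $\mathbb{G}$, $\mathbb{G}^+=\{\varepsilon\in\mathbb{G}\mid 0<\varepsilon\}$ and $\operatorname{Deg}(\mathbb{G})$ is the coinitiality of $\mathbb{G}^+$. A $\mathbb{G}$-metric on $X$ is a map $d\colon X^2\to\mathbb{G}^+\cup\{0\}$ with $d(x,y)=0\iff x=y$, $d(x,y)=d(y,x)$, $d(x,z)\le d(x,y)+d(y,z)$; its topology is generated by the balls $\{y\mid d(x,y)<\varepsilon\}$, $\varepsilon\in\mathbb{G}^+$, and $d$ is compatible with a topology if it generates it. $X$ is $\mathbb{G}$-metrizable if it admits a compatible $\mathbb{G}$-metric. $d$ is Cauchy-complete if every $d$-Cauchy sequence of length $\kappa$ converges. $X$ is $\mathbb{G}$-Polish if it has weight $\le\kappa$ and admits a compatible Cauchy-complete $\mathbb{G}$-metric. 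*)

theory Defs
  imports "HOL-Analysis.Analysis"
begin

unbundle cardinal_syntax

text \<open>
  A cardinal \<open>\<kappa>\<close> is a relation \<open>\<kappa> :: 'k rel\<close> with \<open>card_order \<kappa>\<close>, i.e. an initial well-order
  of the whole type \<open>'k\<close>.  The elements \<open>\<alpha> :: 'k\<close> play the role of the ordinals \<open>\<alpha> < \<kappa>\<close>, and
  the ordinal \<open>\<alpha>\<close>, as the set of its predecessors, is \<open>underS \<kappa> \<alpha>\<close>.
\<close>

section \<open>Sequences, trees and weak compactness\<close>

text \<open>
  A sequence of length \<open>\<alpha> < \<kappa>\<close> is a partial map with domain \<open>underS \<kappa> \<alpha>\<close>, so that its length is
  determined by the map; a sequence of length \<open>\<kappa>\<close> is a total function on \<open>'k\<close>.
\<close>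

definition seqs :: "'k rel \<Rightarrow> 'k \<Rightarrow> ('k \<rightharpoonup> 'b) set" where
  "seqs \<kappa> \<alpha> = {s. dom s = underS \<kappa> \<alpha>}"

definition seqs_lt :: "'k rel \<Rightarrow> ('k \<rightharpoonup> 'b) set" where
  "seqs_lt \<kappa> = (\<Union>\<alpha>. seqs \<kappa> \<alpha>)"

definition seq_tree :: "'k rel \<Rightarrow> ('k \<rightharpoonup> 'b) set \<Rightarrow> bool" where
  "seq_tree \<kappa> T \<longleftrightarrow> T \<subseteq> seqs_lt \<kappa> \<and> (\<forall>s\<in>T. \<forall>\<alpha>. s |` underS \<kappa> \<alpha> \<in> T)"

definition kappa_branch :: "'k rel \<Rightarrow> ('k \<rightharpoonup> 'b) set \<Rightarrow> ('k \<Rightarrow> 'b) \<Rightarrow> bool" where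
  "kappa_branch \<kappa> T b \<longleftrightarrow> (\<forall>\<alpha>. (Some \<circ> b) |` underS \<kappa> \<alpha> \<in> T)"

definition strongly_inaccessible :: "'k rel \<Rightarrow> bool" where
  "strongly_inaccessible \<kappa> \<longleftrightarrow>
     natLeq <o \<kappa> \<and> regularCard \<kappa> \<and> (\<forall>A :: 'k set. |A| <o \<kappa> \<longrightarrow> |Pow A| <o \<kappa>)"

definition weakly_compact :: "'k rel \<Rightarrow> bool" where
  "weakly_compact \<kappa> \<longleftrightarrow> strongly_inaccessible \<kappa> \<and>
     (\<forall>T :: ('k \<rightharpoonup> 'k) set.
        seq_tree \<kappa> T \<and> (\<forall>\<alpha>. T \<inter> seqs \<kappa> \<alpha> \<noteq> {} \<and> |T \<inter> seqs \<kappa> \<alpha>| <o \<kappa>)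
        \<longrightarrow> (\<exists>b. kappa_branch \<kappa> T b))"

section \<open>Topological notions\<close>

definition bounded_topology :: "'k rel \<Rightarrow> ('k \<Rightarrow> bool) topology" where
  "bounded_topology \<kappa> =
     topology_generated_by {{x. s \<subseteq>\<^sub>m Some \<circ> x} | s. s \<in> seqs_lt \<kappa>}"

definition kappa_additive :: "'k rel \<Rightarrow> 'a topology \<Rightarrow> bool" where
  "kappa_additive \<kappa> X \<longleftrightarrow>
     (\<forall>\<U>. \<U> \<noteq> {} \<and> |\<U>| <o \<kappa> \<and> (\<forall>U\<in>\<U>. openin X U) \<longrightarrow> openin X (\<Inter>\<U>))"

definition kappa_Lindelof :: "'k rel \<Rightarrow> 'a topology \<Rightarrow> bool" where
  "kappa_Lindelof \<kappa> X \<longleftrightarrow>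
     (\<forall>\<U>. (\<forall>U\<in>\<U>. openin X U) \<and> \<Union>\<U> = topspace X
        \<longrightarrow> (\<exists>\<V>. \<V> \<subseteq> \<U> \<and> |\<V>| <o \<kappa> \<and> \<Union>\<V> = topspace X))"

definition weight_le :: "'a topology \<Rightarrow> 'k rel \<Rightarrow> bool" where
  "weight_le X \<kappa> \<longleftrightarrow>
     (\<exists>\<B>. |\<B>| \<le>o \<kappa> \<and> (\<forall>B\<in>\<B>. openin X B) \<and>
        (\<forall>U x. openin X U \<and> x \<in> U \<longrightarrow> (\<exists>B\<in>\<B>. x \<in> B \<and> B \<subseteq> U)))"

section \<open>The strong fair Choquet game of length \<open>\<kappa>\<close>\<close>

text \<open>
  A run is given by the sequences \<open>p\<close> of moves \<open>(U\<^sub>\<alpha>, x\<^sub>\<alpha>)\<close> of player I and \<open>V\<close> of moves of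
  player II; at round \<open>\<alpha>\<close> only the values of \<open>V\<close> below \<open>\<alpha>\<close> matter for \<open>game_rest\<close>.  The
  intersection with \<open>topspace X\<close> only matters in round 0.
\<close>

definition game_rest :: "'k rel \<Rightarrow> 'a topology \<Rightarrow> ('k \<Rightarrow> 'a set) \<Rightarrow> 'k \<Rightarrow> 'a set" where
  "game_rest \<kappa> X V \<alpha> = topspace X \<inter> (\<Inter>\<beta>\<in>underS \<kappa> \<alpha>. V \<beta>)"

definition legal_I ::
    "'k rel \<Rightarrow> 'a topology \<Rightarrow> ('k \<Rightarrow> 'a set \<times> 'a) \<Rightarrow> ('k \<Rightarrow> 'a set) \<Rightarrow> 'k \<Rightarrow> bool" where
  "legal_I \<kappa> X p V \<alpha> \<longleftrightarrow>
     openin (subtopology X (game_rest \<kappa> X V \<alpha>)) (fst (p \<alpha>)) \<and> snd (p \<alpha>) \<in> fst (p \<alpha>)"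

definition legal_II ::
    "'k rel \<Rightarrow> 'a topology \<Rightarrow> ('k \<Rightarrow> 'a set \<times> 'a) \<Rightarrow> ('k \<Rightarrow> 'a set) \<Rightarrow> 'k \<Rightarrow> bool" where
  "legal_II \<kappa> X p V \<alpha> \<longleftrightarrow>
     openin (subtopology X (game_rest \<kappa> X V \<alpha>)) (V \<alpha>) \<and>
     snd (p \<alpha>) \<in> V \<alpha> \<and> V \<alpha> \<subseteq> fst (p \<alpha>)"

text \<open>
  A strategy for II maps a position, consisting of the moves of I up to and including the current
  round and the moves of II in the earlier rounds, to the next move of II.
\<close>

type_synonym ('k, 'a) strategy = "('k \<rightharpoonup> 'a set \<times> 'a) \<Rightarrow> ('k \<rightharpoonup> 'a set) \<Rightarrow> 'a set"

definition follows ::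
    "'k rel \<Rightarrow> ('k, 'a) strategy \<Rightarrow> ('k \<Rightarrow> 'a set \<times> 'a) \<Rightarrow> ('k \<Rightarrow> 'a set) \<Rightarrow> 'k \<Rightarrow> bool" where
  "follows \<kappa> \<sigma> p V \<alpha> \<longleftrightarrow>
     V \<alpha> = \<sigma> ((Some \<circ> p) |` under \<kappa> \<alpha>) ((Some \<circ> V) |` underS \<kappa> \<alpha>)"

text \<open>
  A strategy of II is winning if it always answers legally and every run of length \<open>\<kappa>\<close> played
  according to it has nonempty intersection.  Shorter runs need no clause: as II answers legally,
  \<open>game_rest\<close> can become empty only at a limit \<open>\<gamma> < \<kappa>\<close> (or in round 0 if the space is empty); then
  the run is over (I has no legal move) and II has won.
\<close>

definition winning_strategy_II :: "'k rel \<Rightarrow> 'a topology \<Rightarrow> ('k, 'a) strategy \<Rightarrow> bool" where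
  "winning_strategy_II \<kappa> X \<sigma> \<longleftrightarrow>
     (\<forall>p V \<alpha>. (\<forall>\<beta>\<in>under \<kappa> \<alpha>. legal_I \<kappa> X p V \<beta> \<and> follows \<kappa> \<sigma> p V \<beta>)
        \<longrightarrow> legal_II \<kappa> X p V \<alpha>) \<and>
     (\<forall>p V. (\<forall>\<alpha>. legal_I \<kappa> X p V \<alpha> \<and> legal_II \<kappa> X p V \<alpha> \<and> follows \<kappa> \<sigma> p V \<alpha>)
        \<longrightarrow> (\<Inter>\<alpha>. V \<alpha>) \<noteq> {})"

definition fSC_space :: "'k rel \<Rightarrow> 'a topology \<Rightarrow> bool" where
  "fSC_space \<kappa> X \<longleftrightarrow> weight_le X \<kappa> \<and> (\<exists>\<sigma>. winning_strategy_II \<kappa> X \<sigma>)"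

section \<open>Metrics with values in a totally ordered Abelian group\<close>

definition coinitial_in :: "'b::order set \<Rightarrow> 'b set \<Rightarrow> bool" where
  "coinitial_in S A \<longleftrightarrow> A \<subseteq> S \<and> (\<forall>s\<in>S. \<exists>a\<in>A. a \<le> s)"

definition coinitiality_eq :: "'b::order set \<Rightarrow> 'k rel \<Rightarrow> bool" where
  "coinitiality_eq S \<kappa> \<longleftrightarrow>
     (\<exists>A. coinitial_in S A \<and> |A| =o \<kappa>) \<and> (\<forall>A. coinitial_in S A \<longrightarrow> \<kappa> \<le>o |A| )"

definition Deg_eq :: "'g::linordered_ab_group_add itself \<Rightarrow> 'k rel \<Rightarrow> bool" where
  "Deg_eq _ \<kappa> \<longleftrightarrow> coinitiality_eq {\<epsilon>::'g. 0 < \<epsilon>} \<kappa>"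

definition G_metric_on :: "'a set \<Rightarrow> ('a \<Rightarrow> 'a \<Rightarrow> 'g::linordered_ab_group_add) \<Rightarrow> bool" where
  "G_metric_on M d \<longleftrightarrow>
     (\<forall>x\<in>M. \<forall>y\<in>M. 0 \<le> d x y \<and> (d x y = 0 \<longleftrightarrow> x = y) \<and> d x y = d y x) \<and>
     (\<forall>x\<in>M. \<forall>y\<in>M. \<forall>z\<in>M. d x z \<le> d x y + d y z)"

definition G_topology ::
    "'a set \<Rightarrow> ('a \<Rightarrow> 'a \<Rightarrow> 'g::linordered_ab_group_add) \<Rightarrow> 'a topology" where
  "G_topology M d = topology_generated_by {{y\<in>M. d x y < \<epsilon>} | x \<epsilon>. x \<in> M \<and> 0 < \<epsilon>}"

definition compatible_G_metric ::
    "'a topology \<Rightarrow> ('a \<Rightarrow> 'a \<Rightarrow> 'g::linordered_ab_group_add) \<Rightarrow> bool" where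
  "compatible_G_metric X d \<longleftrightarrow> G_metric_on (topspace X) d \<and> G_topology (topspace X) d = X"

definition G_Cauchy ::
    "'k rel \<Rightarrow> ('a \<Rightarrow> 'a \<Rightarrow> 'g::linordered_ab_group_add) \<Rightarrow> ('k \<Rightarrow> 'a) \<Rightarrow> bool" where
  "G_Cauchy \<kappa> d x \<longleftrightarrow>
     (\<forall>\<epsilon>>0. \<exists>\<gamma>. \<forall>\<alpha> \<beta>. (\<gamma>, \<alpha>) \<in> \<kappa> \<and> (\<gamma>, \<beta>) \<in> \<kappa> \<longrightarrow> d (x \<alpha>) (x \<beta>) < \<epsilon>)"

definition G_converges ::
    "'k rel \<Rightarrow> ('a \<Rightarrow> 'a \<Rightarrow> 'g::linordered_ab_group_add) \<Rightarrow> ('k \<Rightarrow> 'a) \<Rightarrow> 'a \<Rightarrow> bool" where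
  "G_converges \<kappa> d x l \<longleftrightarrow> (\<forall>\<epsilon>>0. \<exists>\<gamma>. \<forall>\<alpha>. (\<gamma>, \<alpha>) \<in> \<kappa> \<longrightarrow> d (x \<alpha>) l < \<epsilon>)"

definition Cauchy_complete_on ::
    "'k rel \<Rightarrow> 'a set \<Rightarrow> ('a \<Rightarrow> 'a \<Rightarrow> 'g::linordered_ab_group_add) \<Rightarrow> bool" where
  "Cauchy_complete_on \<kappa> M d \<longleftrightarrow>
     (\<forall>x. range x \<subseteq> M \<and> G_Cauchy \<kappa> d x \<longrightarrow> (\<exists>l\<in>M. G_converges \<kappa> d x l))"

definition G_metrizable :: "'g::linordered_ab_group_add itself \<Rightarrow> 'a topology \<Rightarrow> bool" where
  "G_metrizable _ X \<longleftrightarrow> (\<exists>d :: 'a \<Rightarrow> 'a \<Rightarrow> 'g. compatible_G_metric X d)"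

definition G_Polish ::
    "'k rel \<Rightarrow> 'g::linordered_ab_group_add itself \<Rightarrow> 'a topology \<Rightarrow> bool" where
  "G_Polish \<kappa> _ X \<longleftrightarrow> weight_le X \<kappa> \<and>
     (\<exists>d :: 'a \<Rightarrow> 'a \<Rightarrow> 'g. compatible_G_metric X d \<and> Cauchy_complete_on \<kappa> (topspace X) d)"

end

theory Submission
  imports Defs
begin

text \<open>
  All equivalences come from describing a space by a coding, that is, an embedding into \<open>\<^sup>\<kappa>2\<close>, and
  from the fact that \<open>\<kappa>\<close>-Lindelof \<open>\<kappa>\<close>-additive spaces behave like compact ones.

  A regular \<open>\<kappa>\<close>-additive space is zero-dimensional because \<open>\<kappa>\<close> is uncountable
  (\<open>clopen_neighbourhood\<close>), so if its weight is at most \<open>\<kappa>\<close>, membership in the sets of a clopen base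
  is a coding (\<open>coding_ex\<close>).  If the space is also \<open>\<kappa>\<close>-Lindelof, the set of codes is closed in \<open>\<^sup>\<kappa>2\<close>, for
  the reason for which compact subsets of Hausdorff spaces are closed (\<open>Lindelof_imp_closed_image\<close>).
  This is one half of (e).  It also gives (c): along a decreasing coinitial sequence of length \<open>\<kappa>\<close> in
  \<open>\<G>\<^sup>+\<close>, the position where two codes split becomes a complete ultrametric.  The converse
  from (b) to (a) rests on two facts: fewer than \<open>\<kappa>\<close> positive elements of \<open>\<G>\<close> have a positive lower
  bound, and by the Lindelof property fewer than \<open>\<kappa>\<close> balls of any given radius cover the space.

  For (d), player II just answers with clopen sets.  Complements of clopen sets form open covers,
  so the Lindelof property reduces an empty intersection of length \<open>\<kappa>\<close> to one at an earlier
  round, which is impossible (\<open>Lindelof_additive_imp_winning_strategy\<close>).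

  Conversely, every space with a coding is \<open>\<kappa>\<close>-additive, and has weight at most \<open>\<kappa>\<close> by \<open>2\<^sup><\<^sup>\<kappa> = \<kappa>\<close>.
  If \<open>\<kappa>\<close> is weakly compact and the set of codes is closed, the tree property gives the Lindelof property
  in the way in which Koenig's lemma proves that the Cantor space is compact
  (\<open>weakly_compact_coding_imp_Lindelof\<close>).
\<close>

section \<open>Uncountable regular cardinals\<close>

locale uncountable_regular_cardinal =
  fixes \<kappa> :: "'k rel"
  assumes card_order: "card_order \<kappa>"
    and uncountable: "natLeq <o \<kappa>"
    and regular: "regularCard \<kappa>"
begin

lemma Field_eq [simp]: "Field \<kappa> = UNIV"
  using card_order card_order_on_Card_order by blast

lemma Card_order: "Card_order \<kappa>"
  using card_order by simp

lemma Well_order: "Well_order \<kappa>"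
  using Card_order by (simp add: card_order_on_def)

lemma le_refl [simp]: "(\<alpha>, \<alpha>) \<in> \<kappa>"
  using Well_order wo_rel.REFL[unfolded wo_rel_def, of \<kappa>] by (simp add: refl_on_def)

lemma le_trans: "(\<alpha>, \<beta>) \<in> \<kappa> \<Longrightarrow> (\<beta>, \<gamma>) \<in> \<kappa> \<Longrightarrow> (\<alpha>, \<gamma>) \<in> \<kappa>"
  using wo_rel.TRANS[unfolded wo_rel_def, OF Well_order] by (meson transE)

lemma le_antisym: "(\<alpha>, \<beta>) \<in> \<kappa> \<Longrightarrow> (\<beta>, \<alpha>) \<in> \<kappa> \<Longrightarrow> \<alpha> = \<beta>"
  using wo_rel.ANTISYM[unfolded wo_rel_def, OF Well_order] by (meson antisymD)

lemma le_total: "(\<alpha>, \<beta>) \<in> \<kappa> \<or> (\<beta>, \<alpha>) \<in> \<kappa>"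
  using wo_rel.TOTALS[unfolded wo_rel_def, OF Well_order] by simp

lemma wf_strict: "wf (\<kappa> - Id)"
  using Well_order by (simp add: well_order_on_def)

lemma underS_mono: "(\<alpha>, \<beta>) \<in> \<kappa> \<Longrightarrow> underS \<kappa> \<alpha> \<subseteq> underS \<kappa> \<beta>"
  unfolding underS_def using le_trans le_antisym by blast

lemma not_in_underS: "\<alpha> \<notin> underS \<kappa> \<beta> \<longleftrightarrow> (\<beta>, \<alpha>) \<in> \<kappa>"
  unfolding underS_def using le_total le_antisym by auto

lemma Cinfinite: "Cinfinite \<kappa>"
  using natLeq_Cinfinite Card_order uncountable
  by (meson cinfinite_mono ordLess_imp_ordLeq)

lemma infinite_UNIV: "infinite (UNIV :: 'k set)"
  using Cinfinite by (simp add: cinfinite_def)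

lemma card_UNIV: "|UNIV :: 'k set| =o \<kappa>"
  using card_of_unique[OF card_order] ordIso_symmetric by blast

lemma ordLess_finite: "finite A \<Longrightarrow> |A| <o \<kappa>"
  using finite_ordLess_infinite[OF card_of_Well_order Well_order] infinite_UNIV
  by (simp add: Field_card_of)

lemma ordLess_countable: "countable A \<Longrightarrow> |A| <o \<kappa>"
  using uncountable unfolding countable_def
  by (meson card_of_nat card_of_ordLeq ordLeq_ordIso_trans ordLeq_ordLess_trans subset_UNIV)

lemma ordLess_subset: "A \<subseteq> B \<Longrightarrow> |B| <o \<kappa> \<Longrightarrow> |A| <o \<kappa>"
  using card_of_mono1 ordLeq_ordLess_trans by blast

lemma ordLess_image: "|A| <o \<kappa> \<Longrightarrow> |f ` A| <o \<kappa>"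
  using card_of_image ordLeq_ordLess_trans by blast

lemma ordLess_Un: "|A| <o \<kappa> \<Longrightarrow> |B| <o \<kappa> \<Longrightarrow> |A \<union> B| <o \<kappa>"
  using card_of_Un_ordLess_infinite_Field[of \<kappa> A B] infinite_UNIV Card_order by simp

lemma ordLess_UNION: "|I| <o \<kappa> \<Longrightarrow> (\<And>i. i \<in> I \<Longrightarrow> |A i| <o \<kappa>) \<Longrightarrow> |\<Union>i\<in>I. A i| <o \<kappa>"
  using regularCard_UNION_bound[OF Cinfinite regular] by blast

lemma ordLess_underS: "|underS \<kappa> \<alpha>| <o \<kappa>"
  using card_of_underS[OF Card_order] by simp

lemma bounded_if_small:
  assumes "|A| <o \<kappa>"
  obtains \<gamma> where "\<And>\<alpha>. \<alpha> \<in> A \<Longrightarrow> (\<alpha>, \<gamma>) \<in> \<kappa>"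
proof -
  have "\<not> cofinal A \<kappa>"
    using regular assms not_ordLess_ordIso unfolding regularCard_def by auto
  then obtain \<gamma> where "\<forall>\<alpha>\<in>A. \<gamma> = \<alpha> \<or> (\<gamma>, \<alpha>) \<notin> \<kappa>"
    by (auto simp: cofinal_def)
  then have "\<And>\<alpha>. \<alpha> \<in> A \<Longrightarrow> (\<alpha>, \<gamma>) \<in> \<kappa>"
    using le_total by (metis le_refl)
  then show ?thesis
    by (rule that)
qed

lemma above_ex: obtains \<beta> where "\<alpha> \<in> underS \<kappa> \<beta>"
  using infinite_Card_order_limit[OF Card_order, of \<alpha>] infinite_UNIV
  by (auto simp: underS_def)

lemma enumeration:
  assumes "|A| \<le>o \<kappa>" and "A \<noteq> {}"
  obtains a :: "'k \<Rightarrow> 'b" where "range a = A"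
proof -
  have "|A| \<le>o |UNIV :: 'k set|"
    using assms(1) card_UNIV ordIso_symmetric ordLeq_ordIso_trans by blast
  then show ?thesis
    using card_of_ordLeq2[OF assms(2)] that by metis
qed

lemma ordLeq_image: "|A| \<le>o \<kappa> \<Longrightarrow> |f ` A| \<le>o \<kappa>"
  using card_of_image ordLeq_transitive by blast

lemma ordLeq_Times: "|A| \<le>o \<kappa> \<Longrightarrow> |B| \<le>o \<kappa> \<Longrightarrow> |A \<times> B| \<le>o \<kappa>"
  using card_of_Times_ordLeq_infinite_Field[of \<kappa> A B] infinite_UNIV Card_order by simp

lemma ordLeq_UNION: "|I| \<le>o \<kappa> \<Longrightarrow> (\<And>i. i \<in> I \<Longrightarrow> |A i| \<le>o \<kappa>) \<Longrightarrow> |\<Union>i\<in>I. A i| \<le>o \<kappa>"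
  using card_of_UNION_ordLeq_infinite_Field[of \<kappa> I A] infinite_UNIV Card_order by simp

end

section \<open>Topologies given by a base\<close>

lemma openin_topology_generated_by_base:
  assumes "\<And>A B x. A \<in> S \<Longrightarrow> B \<in> S \<Longrightarrow> x \<in> A \<Longrightarrow> x \<in> B \<Longrightarrow> \<exists>C\<in>S. x \<in> C \<and> C \<subseteq> A \<inter> B"
  shows "openin (topology_generated_by S) U \<longleftrightarrow> (\<forall>x\<in>U. \<exists>B\<in>S. x \<in> B \<and> B \<subseteq> U)"
proof
  assume "openin (topology_generated_by S) U"
  then have "generate_topology_on S U"
    by (simp add: openin_topology_generated_by_iff)
  then show "\<forall>x\<in>U. \<exists>B\<in>S. x \<in> B \<and> B \<subseteq> U"
  proof induction
    case (Int A B)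
    show ?case
    proof
      fix x assume "x \<in> A \<inter> B"
      then obtain A' B' where "A' \<in> S" "x \<in> A'" "A' \<subseteq> A" "B' \<in> S" "x \<in> B'" "B' \<subseteq> B"
        using Int.IH by blast
      with assms[of A' B' x] show "\<exists>C\<in>S. x \<in> C \<and> C \<subseteq> A \<inter> B"
        by blast
    qed
  next
    case (UN K)
    then show ?case
      by (meson Sup_upper UnionE subset_trans)
  qed auto
next
  assume "\<forall>x\<in>U. \<exists>B\<in>S. x \<in> B \<and> B \<subseteq> U"
  then show "openin (topology_generated_by S) U"
    by (subst openin_subopen) (meson topology_generated_by_Basis)
qed

lemma openin_G_topology:
  assumes d: "G_metric_on M d"
  shows "openin (G_topology M d) U \<longleftrightarrow>
           U \<subseteq> M \<and> (\<forall>x\<in>U. \<exists>\<epsilon>>0. {y\<in>M. d x y < \<epsilon>} \<subseteq> U)"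
proof -
  define S where "S = {{y\<in>M. d x y < \<epsilon>} | x \<epsilon>. x \<in> M \<and> 0 < \<epsilon>}"
  have recentre: "\<exists>\<delta>>0. {y\<in>M. d z y < \<delta>} \<subseteq> {y\<in>M. d x y < \<epsilon>}"
    if "x \<in> M" "z \<in> M" "d x z < \<epsilon>" for x z \<epsilon>
  proof (intro exI conjI subsetI)
    show "0 < \<epsilon> - d x z"
      using that by simp
    fix y assume y: "y \<in> {y\<in>M. d z y < \<epsilon> - d x z}"
    then have "d x y \<le> d x z + d z y"
      using d that by (auto simp: G_metric_on_def)
    also have "\<dots> < \<epsilon>"
      using y by (simp add: algebra_simps)
    finally show "y \<in> {y\<in>M. d x y < \<epsilon>}"
      using y by simp
  qed
  have centre: "x \<in> {y\<in>M. d x y < \<epsilon>}" if "x \<in> M" "0 < \<epsilon>" for x \<epsilon>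
  proof -
    note that
    moreover have "d x x = 0"
      using d \<open>x \<in> M\<close> unfolding G_metric_on_def by blast
    ultimately show ?thesis
      by simp
  qed
  have "openin (topology_generated_by S) U \<longleftrightarrow> (\<forall>x\<in>U. \<exists>B\<in>S. x \<in> B \<and> B \<subseteq> U)"
  proof (rule openin_topology_generated_by_base)
    fix A B z assume "A \<in> S" "B \<in> S" and z: "z \<in> A" "z \<in> B"
    then obtain x \<epsilon> y \<delta> where A: "A = {w\<in>M. d x w < \<epsilon>}" "x \<in> M"
      and B: "B = {w\<in>M. d y w < \<delta>}" "y \<in> M"
      by (auto simp: S_def)
    obtain \<epsilon>' where e: "\<epsilon>' > 0" "{w\<in>M. d z w < \<epsilon>'} \<subseteq> A"
      using recentre A z by blast
    obtain \<delta>' where d: "\<delta>' > 0" "{w\<in>M. d z w < \<delta>'} \<subseteq> B"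
      using recentre B z by blast
    have "{w\<in>M. d z w < min \<epsilon>' \<delta>'} \<subseteq> A \<inter> B"
      using e d by auto
    moreover have "{w\<in>M. d z w < min \<epsilon>' \<delta>'} \<in> S"
      using e d z A unfolding S_def by (intro CollectI exI[of _ z] exI[of _ "min \<epsilon>' \<delta>'"]) simp
    moreover have "z \<in> {w\<in>M. d z w < min \<epsilon>' \<delta>'}"
      using centre[of z "min \<epsilon>' \<delta>'"] e d z A by auto
    ultimately show "\<exists>C\<in>S. z \<in> C \<and> C \<subseteq> A \<inter> B"
      by (intro bexI[of _ "{w\<in>M. d z w < min \<epsilon>' \<delta>'}"] conjI)
  qed
  also have "\<dots> \<longleftrightarrow> U \<subseteq> M \<and> (\<forall>x\<in>U. \<exists>\<epsilon>>0. {y\<in>M. d x y < \<epsilon>} \<subseteq> U)" (is "?l \<longleftrightarrow> ?r")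
  proof
    assume l: ?l
    show ?r
    proof (intro conjI ballI)
      show "U \<subseteq> M"
        using l by (auto simp: S_def)
      fix x assume "x \<in> U"
      then obtain B where "B \<in> S" "x \<in> B" "B \<subseteq> U"
        using l by blast
      then obtain z \<epsilon> where z: "z \<in> M" "x \<in> M" "d z x < \<epsilon>" "{y\<in>M. d z y < \<epsilon>} \<subseteq> U"
        by (auto simp: S_def)
      show "\<exists>\<epsilon>>0. {y\<in>M. d x y < \<epsilon>} \<subseteq> U"
        using recentre[OF z(1,2,3)] z(4) by (meson subset_trans)
    qed
  next
    assume r: ?r
    show ?l
    proof
      fix x assume "x \<in> U"
      with r obtain \<epsilon> where "\<epsilon> > 0" "{y\<in>M. d x y < \<epsilon>} \<subseteq> U" "x \<in> M"
        by blast
      then show "\<exists>B\<in>S. x \<in> B \<and> B \<subseteq> U"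
        using centre by (intro bexI[of _ "{y\<in>M. d x y < \<epsilon>}"]) (auto simp: S_def)
    qed
  qed
  finally show ?thesis
    by (simp add: G_topology_def S_def)
qed

context uncountable_regular_cardinal
begin

text \<open>
  The cylinders over the initial segments of a point form a neighbourhood base of it, and any two
  of them are nested; this is why the generating sets are already a base.
\<close>

lemma openin_bounded_topology:
  "openin (bounded_topology \<kappa>) U \<longleftrightarrow>
     (\<forall>x\<in>U. \<exists>\<gamma>. {y. \<forall>\<alpha>\<in>underS \<kappa> \<gamma>. y \<alpha> = x \<alpha>} \<subseteq> U)"
proof -
  define S :: "('k \<Rightarrow> bool) set set" where "S = {{x. s \<subseteq>\<^sub>m Some \<circ> x} | s. s \<in> seqs_lt \<kappa>}"
  have cyl: "{y. s \<subseteq>\<^sub>m Some \<circ> y} = {y. \<forall>\<alpha>\<in>underS \<kappa> \<gamma>. y \<alpha> = x \<alpha>}"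
    if "s \<subseteq>\<^sub>m Some \<circ> x" "dom s = underS \<kappa> \<gamma>" for s :: "'k \<rightharpoonup> bool" and x \<gamma>
    using that by (fastforce simp: map_le_def)
  have cyl_in: "{y. \<forall>\<alpha>\<in>underS \<kappa> \<gamma>. y \<alpha> = x \<alpha>} \<in> S" for x \<gamma>
    unfolding S_def
  proof (intro CollectI exI conjI)
    show "{y. \<forall>\<alpha>\<in>underS \<kappa> \<gamma>. y \<alpha> = x \<alpha>} = {y. (Some \<circ> x) |` underS \<kappa> \<gamma> \<subseteq>\<^sub>m Some \<circ> y}"
      by (rule cyl[symmetric]) (auto simp: map_le_def dom_def restrict_map_def)
    show "(Some \<circ> x) |` underS \<kappa> \<gamma> \<in> seqs_lt \<kappa>"
      by (auto simp: seqs_lt_def seqs_def)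
  qed
  have cylE: "\<exists>\<gamma>. A = {y. \<forall>\<alpha>\<in>underS \<kappa> \<gamma>. y \<alpha> = x \<alpha>}" if A: "A \<in> S" "x \<in> A" for A x
  proof -
    obtain s \<gamma> where "A = {x. s \<subseteq>\<^sub>m Some \<circ> x}" "dom s = underS \<kappa> \<gamma>"
      using A(1) unfolding S_def seqs_lt_def seqs_def by blast
    with A(2) cyl[of s x \<gamma>] show ?thesis
      by blast
  qed
  have "openin (topology_generated_by S) U \<longleftrightarrow> (\<forall>x\<in>U. \<exists>B\<in>S. x \<in> B \<and> B \<subseteq> U)"
  proof (rule openin_topology_generated_by_base)
    fix A B x assume "A \<in> S" "B \<in> S" "x \<in> A" "x \<in> B"
    obtain \<gamma> where A: "A = {y. \<forall>\<alpha>\<in>underS \<kappa> \<gamma>. y \<alpha> = x \<alpha>}"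
      using cylE[OF \<open>A \<in> S\<close> \<open>x \<in> A\<close>] by blast
    obtain \<delta> where B: "B = {y. \<forall>\<alpha>\<in>underS \<kappa> \<delta>. y \<alpha> = x \<alpha>}"
      using cylE[OF \<open>B \<in> S\<close> \<open>x \<in> B\<close>] by blast
    have "A \<subseteq> B \<or> B \<subseteq> A"
      using A B le_total[of \<gamma> \<delta>] underS_mono by blast
    then show "\<exists>C\<in>S. x \<in> C \<and> C \<subseteq> A \<inter> B"
      using \<open>A \<in> S\<close> \<open>B \<in> S\<close> \<open>x \<in> A\<close> \<open>x \<in> B\<close> by blast
  qed
  also have "\<dots> \<longleftrightarrow> (\<forall>x\<in>U. \<exists>\<gamma>. {y. \<forall>\<alpha>\<in>underS \<kappa> \<gamma>. y \<alpha> = x \<alpha>} \<subseteq> U)"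
  proof (intro ball_cong refl iffI)
    fix x assume "\<exists>B\<in>S. x \<in> B \<and> B \<subseteq> U"
    then obtain B where B: "B \<in> S" "x \<in> B" "B \<subseteq> U"
      by blast
    show "\<exists>\<gamma>. {y. \<forall>\<alpha>\<in>underS \<kappa> \<gamma>. y \<alpha> = x \<alpha>} \<subseteq> U"
      using cylE[OF B(1,2)] B(3) by auto
  next
    fix x assume "\<exists>\<gamma>. {y. \<forall>\<alpha>\<in>underS \<kappa> \<gamma>. y \<alpha> = x \<alpha>} \<subseteq> U"
    then obtain \<gamma> where "{y. \<forall>\<alpha>\<in>underS \<kappa> \<gamma>. y \<alpha> = x \<alpha>} \<subseteq> U"
      by blast
    then show "\<exists>B\<in>S. x \<in> B \<and> B \<subseteq> U"
      by (intro bexI[OF _ cyl_in[of \<gamma> x]]) simp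
  qed
  finally show ?thesis
    by (simp add: bounded_topology_def S_def)
qed

lemma topspace_bounded_topology [simp]: "topspace (bounded_topology \<kappa>) = UNIV"
proof -
  have "openin (bounded_topology \<kappa>) UNIV"
    unfolding openin_bounded_topology by simp
  then show ?thesis
    using openin_subset by blast
qed


section \<open>Codings by branches of the binary tree\<close>

text \<open>
  The set of points whose code extends the restriction of \<open>z\<close> to \<open>\<gamma>\<close>.  It may be empty, since \<open>z\<close>
  need not be the code of a point; how early it becomes empty is what the closedness of the set of
  codes is about.
\<close>

definition agree :: "'a topology \<Rightarrow> ('a \<Rightarrow> 'k \<Rightarrow> bool) \<Rightarrow> ('k \<Rightarrow> bool) \<Rightarrow> 'k \<Rightarrow> 'a set" where
  "agree X f z \<gamma> = {y \<in> topspace X. \<forall>\<alpha>\<in>underS \<kappa> \<gamma>. f y \<alpha> = z \<alpha>}"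

text \<open>
  A coding is an embedding into \<open>\<^sup>\<kappa>2\<close>.  The topological content is put into one equivalence about
  open sets, which refers only to the points of the space, so that metrics, games and trees can be
  handled without passing to the image; \<open>coding_iff_homeomorphic_map\<close> translates it back.
\<close>

definition coding :: "'a topology \<Rightarrow> ('a \<Rightarrow> 'k \<Rightarrow> bool) \<Rightarrow> bool" where
  "coding X f \<longleftrightarrow> inj_on f (topspace X) \<and>
     (\<forall>U. openin X U \<longleftrightarrow> U \<subseteq> topspace X \<and> (\<forall>x\<in>U. \<exists>\<gamma>. agree X f (f x) \<gamma> \<subseteq> U))"

lemma agree_subset: "agree X f z \<gamma> \<subseteq> topspace X"
  by (auto simp: agree_def)

lemma agree_antimono: "(\<gamma>, \<delta>) \<in> \<kappa> \<Longrightarrow> agree X f z \<delta> \<subseteq> agree X f z \<gamma>"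
  using underS_mono by (fastforce simp: agree_def)

lemma agree_self: "x \<in> topspace X \<Longrightarrow> x \<in> agree X f (f x) \<gamma>"
  by (simp add: agree_def)

lemma agree_recentre: "y \<in> agree X f z \<gamma> \<Longrightarrow> agree X f (f y) \<gamma> = agree X f z \<gamma>"
  by (auto simp: agree_def)

lemma coding_inj: "coding X f \<Longrightarrow> inj_on f (topspace X)"
  by (simp add: coding_def)

lemma coding_openin:
  "coding X f \<Longrightarrow> openin X U \<longleftrightarrow> U \<subseteq> topspace X \<and> (\<forall>x\<in>U. \<exists>\<gamma>. agree X f (f x) \<gamma> \<subseteq> U)"
  by (simp add: coding_def)

lemma coding_openin_agree: "coding X f \<Longrightarrow> openin X (agree X f z \<gamma>)"
  using agree_recentre agree_subset by (fastforce simp: coding_openin)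

lemma openin_subtopology_bounded_topology:
  "openin (subtopology (bounded_topology \<kappa>) C) S \<longleftrightarrow>
     S \<subseteq> C \<and> (\<forall>x\<in>S. \<exists>\<gamma>. {y\<in>C. \<forall>\<alpha>\<in>underS \<kappa> \<gamma>. y \<alpha> = x \<alpha>} \<subseteq> S)"
  (is "?l \<longleftrightarrow> ?r")
proof
  assume ?l
  then obtain W where W: "openin (bounded_topology \<kappa>) W" "S = W \<inter> C"
    by (auto simp: openin_subtopology)
  show ?r
  proof (intro conjI ballI)
    show "S \<subseteq> C"
      using W by simp
    fix x assume "x \<in> S"
    then obtain \<gamma> where "{y. \<forall>\<alpha>\<in>underS \<kappa> \<gamma>. y \<alpha> = x \<alpha>} \<subseteq> W"
      using W openin_bounded_topology by blast
    then show "\<exists>\<gamma>. {y\<in>C. \<forall>\<alpha>\<in>underS \<kappa> \<gamma>. y \<alpha> = x \<alpha>} \<subseteq> S"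
      using W by blast
  qed
next
  assume r: ?r
  define W where "W = {y. \<exists>\<gamma>. {z\<in>C. \<forall>\<alpha>\<in>underS \<kappa> \<gamma>. z \<alpha> = y \<alpha>} \<subseteq> S}"
  have "openin (bounded_topology \<kappa>) W"
    unfolding openin_bounded_topology
  proof
    fix x assume "x \<in> W"
    then obtain \<gamma> where \<gamma>: "{z\<in>C. \<forall>\<alpha>\<in>underS \<kappa> \<gamma>. z \<alpha> = x \<alpha>} \<subseteq> S"
      by (auto simp: W_def)
    have "{y. \<forall>\<alpha>\<in>underS \<kappa> \<gamma>. y \<alpha> = x \<alpha>} \<subseteq> W"
    proof
      fix y assume "y \<in> {y. \<forall>\<alpha>\<in>underS \<kappa> \<gamma>. y \<alpha> = x \<alpha>}"
      then have "{z\<in>C. \<forall>\<alpha>\<in>underS \<kappa> \<gamma>. z \<alpha> = y \<alpha>} = {z\<in>C. \<forall>\<alpha>\<in>underS \<kappa> \<gamma>. z \<alpha> = x \<alpha>}"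
        by auto
      with \<gamma> have "{z\<in>C. \<forall>\<alpha>\<in>underS \<kappa> \<gamma>. z \<alpha> = y \<alpha>} \<subseteq> S"
        by simp
      then show "y \<in> W"
        unfolding W_def by (intro CollectI exI)
    qed
    then show "\<exists>\<gamma>. {y. \<forall>\<alpha>\<in>underS \<kappa> \<gamma>. y \<alpha> = x \<alpha>} \<subseteq> W"
      by (rule exI)
  qed
  moreover have "S = W \<inter> C"
  proof
    show "S \<subseteq> W \<inter> C"
      using r by (simp add: W_def subset_iff)
    show "W \<inter> C \<subseteq> S"
      by (auto simp: W_def)
  qed
  ultimately show ?l
    by (auto simp: openin_subtopology)
qed

lemma coding_iff_homeomorphic_map:
  "coding X f \<longleftrightarrow> homeomorphic_map X (subtopology (bounded_topology \<kappa>) (f ` topspace X)) f"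
  (is "_ \<longleftrightarrow> homeomorphic_map X ?Y f")
proof -
  have image: "openin ?Y (f ` U) \<longleftrightarrow> (\<forall>x\<in>U. \<exists>\<gamma>. agree X f (f x) \<gamma> \<subseteq> U)"
    if inj: "inj_on f (topspace X)" and U: "U \<subseteq> topspace X" for U
  proof -
    have "{y \<in> f ` topspace X. \<forall>\<alpha>\<in>underS \<kappa> \<gamma>. y \<alpha> = f x \<alpha>} = f ` agree X f (f x) \<gamma>" for x \<gamma>
      by (auto simp: agree_def)
    moreover have "f ` agree X f (f x) \<gamma> \<subseteq> f ` U \<longleftrightarrow> agree X f (f x) \<gamma> \<subseteq> U" for x \<gamma>
      using inj_on_image_subset_iff[OF inj agree_subset U] by blast
    ultimately show ?thesis
      using U by (simp add: openin_subtopology_bounded_topology image_mono)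
  qed
  show ?thesis
  proof
    assume f: "coding X f"
    show "homeomorphic_map X ?Y f"
    proof (rule bijective_open_imp_homeomorphic_map)
      have *: "openin X {x \<in> topspace X. f x \<in> V}" if "openin ?Y V" for V
      proof -
        have "V \<subseteq> f ` topspace X"
          using that openin_subset by fastforce
        then have "f ` {x \<in> topspace X. f x \<in> V} = V"
          by blast
        then show ?thesis
          using image[OF coding_inj[OF f], of "{x \<in> topspace X. f x \<in> V}"] that
          by (simp add: coding_openin[OF f])
      qed
      then show "continuous_map X ?Y f"
        by (auto simp: continuous_map_def)
      show "open_map X ?Y f"
        using image[OF coding_inj[OF f]] f by (auto simp: open_map_def coding_openin)
    qed (use f coding_inj in auto)
  next
    assume f: "homeomorphic_map X ?Y f"
    then have inj: "inj_on f (topspace X)"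
      by (rule homeomorphic_imp_injective_map)
    show "coding X f"
      unfolding coding_def using inj homeomorphic_map_openness_eq[OF f] image[OF inj] by auto
  qed
qed

section \<open>Clopen sets\<close>

lemma additive_INT:
  assumes "kappa_additive \<kappa> X" and "|I| <o \<kappa>" and "\<And>i. i \<in> I \<Longrightarrow> openin X (U i)"
  shows "openin X (topspace X \<inter> (\<Inter>i\<in>I. U i))"
proof (cases "I = {}")
  case False
  then have "openin X (\<Inter>i\<in>I. U i)"
    using assms(2,3) ordLess_image[of I U]
    by (intro assms(1)[unfolded kappa_additive_def, rule_format]) auto
  then show ?thesis
    by (simp add: openin_Int)
qed simp

text \<open>
  Regularity gives a sequence \<open>W\<^sub>0 \<supseteq> K\<^sub>0 \<supseteq> W\<^sub>1 \<supseteq> K\<^sub>1 \<supseteq> \<dots>\<close> of alternately open and closed neighbourhoods.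
  Its intersection is closed because of the \<open>K\<^sub>n\<close>, and open because of the \<open>W\<^sub>n\<close>, as \<open>\<kappa>\<close> is uncountable
  and countable intersections of open sets are open.
\<close>

lemma clopen_neighbourhood:
  assumes add: "kappa_additive \<kappa> X" and "regular_space X" and "openin X U" and "x \<in> U"
  obtains C where "openin X C" "closedin X C" "x \<in> C" "C \<subseteq> U"
proof -
  have "neighbourhood_base_of (closedin X) X"
    using assms(2) by (simp add: neighbourhood_base_of_closedin)
  then have shrink: "\<exists>W' K. openin X W' \<and> closedin X K \<and> x \<in> W' \<and> W' \<subseteq> K \<and> K \<subseteq> W"
    if "openin X W" "x \<in> W" for W
    using that by (simp add: neighbourhood_base_of)
  have "\<exists>W. \<forall>n. (openin X (W n) \<and> x \<in> W n \<and> W n \<subseteq> U) \<and>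
          (\<exists>K. closedin X K \<and> W (Suc n) \<subseteq> K \<and> K \<subseteq> W n)"
  proof (rule dependent_nat_choice)
    show "\<exists>W. openin X W \<and> x \<in> W \<and> W \<subseteq> U"
      using assms by blast
    fix W :: "'a set" and n :: nat
    assume W: "openin X W \<and> x \<in> W \<and> W \<subseteq> U"
    then show "\<exists>W'. (openin X W' \<and> x \<in> W' \<and> W' \<subseteq> U) \<and>
                  (\<exists>K. closedin X K \<and> W' \<subseteq> K \<and> K \<subseteq> W)"
      using shrink[of W] by (meson subset_trans)
  qed
  then obtain W where "\<forall>n. (openin X (W n) \<and> x \<in> W n \<and> W n \<subseteq> U) \<and>
      (\<exists>K. closedin X K \<and> W (Suc n) \<subseteq> K \<and> K \<subseteq> W n)" ..
  then have W: "openin X (W n)" "x \<in> W n" "W n \<subseteq> U"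
    and "\<exists>K. closedin X K \<and> W (Suc n) \<subseteq> K \<and> K \<subseteq> W n" for n
    by simp_all
  then obtain K where K: "\<And>n. closedin X (K n)" "\<And>n. W (Suc n) \<subseteq> K n" "\<And>n. K n \<subseteq> W n"
    by metis
  have "openin X (topspace X \<inter> (\<Inter>n. W n))"
    using W by (intro additive_INT[OF add] ordLess_countable) auto
  also have "topspace X \<inter> (\<Inter>n. W n) = (\<Inter>n. W n)"
    using W openin_subset by fastforce
  finally have "openin X (\<Inter>n. W n)" .
  moreover have "(\<Inter>n. W n) = (\<Inter>n. K n)"
  proof (intro antisym INF_greatest)
    show "(\<Inter>n. W n) \<subseteq> K n" for n
      using K(2)[of n] by blast
    show "(\<Inter>n. K n) \<subseteq> W n" for n
      using K(3)[of n] by blast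
  qed
  then have "closedin X (\<Inter>n. W n)"
    using K(1) by (auto intro: closedin_Inter)
  moreover have "(\<Inter>n. W n) \<subseteq> U"
    using W(3)[of 0] by blast
  ultimately show ?thesis
    using W(2) by (intro that[of "\<Inter>n. W n"]) auto
qed

text \<open>
  Zero-dimensionality alone yields a clopen base of unknown size.  To have only \<open>\<kappa>\<close> members, choose one
  clopen set between \<open>B\<close> and \<open>B'\<close> for each pair \<open>(B, B')\<close> of members of a base of size at most \<open>\<kappa>\<close> for
  which there is one.
\<close>

lemma clopen_base_enumeration:
  assumes add: "kappa_additive \<kappa> X" and reg: "regular_space X" and "weight_le X \<kappa>"
  obtains c :: "'k \<Rightarrow> 'a set" where "\<And>\<alpha>. openin X (c \<alpha>)" "\<And>\<alpha>. closedin X (c \<alpha>)"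
    "\<And>U x. openin X U \<Longrightarrow> x \<in> U \<Longrightarrow> \<exists>\<alpha>. x \<in> c \<alpha> \<and> c \<alpha> \<subseteq> U"
proof -
  obtain \<B> where card: "|\<B>| \<le>o \<kappa>" and op: "\<And>B. B \<in> \<B> \<Longrightarrow> openin X B"
    and base: "\<And>U x. openin X U \<Longrightarrow> x \<in> U \<Longrightarrow> \<exists>B\<in>\<B>. x \<in> B \<and> B \<subseteq> U"
    using assms(3) unfolding weight_le_def by (elim exE conjE) simp
  define between where "between B C \<longleftrightarrow> openin X C \<and> closedin X C \<and> fst B \<subseteq> C \<and> C \<subseteq> snd B"
    for B :: "'a set \<times> 'a set" and C
  \<comment> \<open>The default value \<open>{}\<close> is clopen, so that no pair of the base has to be discarded.\<close>
  define pick where "pick B = (if \<exists>C. between B C then SOME C. between B C else {})" for B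
  have pick: "openin X (pick B)" "closedin X (pick B)" for B
    using someI_ex[of "between B"] by (auto simp: pick_def between_def)
  have fine: "\<exists>C \<in> pick ` (\<B> \<times> \<B>). x \<in> C \<and> C \<subseteq> U" if U: "openin X U" "x \<in> U" for U x
  proof -
    obtain B2 where B2: "B2 \<in> \<B>" "x \<in> B2" "B2 \<subseteq> U"
      using base U by blast
    obtain C where C: "openin X C" "closedin X C" "x \<in> C" "C \<subseteq> B2"
      using clopen_neighbourhood[OF add reg op] B2 by metis
    obtain B1 where B1: "B1 \<in> \<B>" "x \<in> B1" "B1 \<subseteq> C"
      using base C by blast
    have ex: "between (B1, B2) C"
      using B1 C by (simp add: between_def)
    then have "between (B1, B2) (pick (B1, B2))"
      using someI_ex[of "between (B1, B2)"] by (auto simp: pick_def)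
    then show ?thesis
      using B1 B2 by (intro bexI[of _ "pick (B1, B2)"]) (auto simp: between_def)
  qed
  show ?thesis
  proof (cases "\<B> = {}")
    case True
    then show ?thesis
      using base by (intro that[of "\<lambda>_. {}"]) auto
  next
    case False
    have "|pick ` (\<B> \<times> \<B>)| \<le>o \<kappa>"
      by (intro ordLeq_image ordLeq_Times card)
    then obtain c :: "'k \<Rightarrow> 'a set" where c: "range c = pick ` (\<B> \<times> \<B>)"
      by (rule enumeration) (simp add: False)
    show ?thesis
    proof (rule that[of c])
      show "openin X (c \<alpha>)" "closedin X (c \<alpha>)" for \<alpha>
        using c pick by (metis image_iff rangeI)+
      show "\<exists>\<alpha>. x \<in> c \<alpha> \<and> c \<alpha> \<subseteq> U" if "openin X U" "x \<in> U" for U x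
        using fine[OF that] unfolding c[symmetric] by blast
    qed
  qed
qed

text \<open>
  The code of a point is the characteristic function of the set of indices of its neighbourhoods in
  an enumerated clopen base.  Additivity makes the sets \<open>agree\<close> open although they are determined by
  infinitely many coordinates; the Hausdorff property makes the coding injective.
\<close>

lemma coding_ex:
  assumes add: "kappa_additive \<kappa> X" and "regular_space X" and "Hausdorff_space X"
    and "weight_le X \<kappa>"
  obtains f where "coding X f"
proof -
  obtain c :: "'k \<Rightarrow> 'a set" where op: "\<And>\<alpha>. openin X (c \<alpha>)" and cl: "\<And>\<alpha>. closedin X (c \<alpha>)"
    and base: "\<And>U x. openin X U \<Longrightarrow> x \<in> U \<Longrightarrow> \<exists>\<alpha>. x \<in> c \<alpha> \<and> c \<alpha> \<subseteq> U"
    using clopen_base_enumeration assms by metis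
  define f where "f x \<alpha> \<longleftrightarrow> x \<in> c \<alpha>" for x \<alpha>
  have agree_open: "openin X (agree X f z \<gamma>)" for z \<gamma>
  proof -
    define D where "D \<alpha> = (if z \<alpha> then c \<alpha> else topspace X - c \<alpha>)" for \<alpha>
    have "openin X (D \<alpha>)" for \<alpha>
      using op cl by (simp add: D_def openin_diff)
    then have "openin X (topspace X \<inter> (\<Inter>\<alpha>\<in>underS \<kappa> \<gamma>. D \<alpha>))"
      by (intro additive_INT[OF add] ordLess_underS)
    also have "topspace X \<inter> (\<Inter>\<alpha>\<in>underS \<kappa> \<gamma>. D \<alpha>) = agree X f z \<gamma>"
    proof -
      have "y \<in> D \<alpha> \<longleftrightarrow> f y \<alpha> = z \<alpha>" if "y \<in> topspace X" for y \<alpha>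
        using that by (simp add: D_def f_def)
      then show ?thesis
        by (auto simp: agree_def)
    qed
    finally show ?thesis .
  qed
  have "coding X f"
    unfolding coding_def
  proof (intro conjI allI)
    show "inj_on f (topspace X)"
    proof (rule inj_onI, rule ccontr)
      fix x y assume "x \<in> topspace X" "y \<in> topspace X" and eq: "f x = f y" and "x \<noteq> y"
      then obtain U V where "openin X U" "x \<in> U" "openin X V" "y \<in> V" "disjnt U V"
        using \<open>Hausdorff_space X\<close> unfolding Hausdorff_space_def by meson
      then obtain \<alpha> where "x \<in> c \<alpha>" "y \<notin> c \<alpha>"
        using base by (metis disjnt_iff subsetD)
      then show False
        using eq unfolding f_def by metis
    qed
    fix U
    show "openin X U \<longleftrightarrow> U \<subseteq> topspace X \<and> (\<forall>x\<in>U. \<exists>\<gamma>. agree X f (f x) \<gamma> \<subseteq> U)" (is "?l \<longleftrightarrow> ?r")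
    proof
      assume U: ?l
      show ?r
      proof (intro conjI ballI)
        show "U \<subseteq> topspace X"
          using U by (rule openin_subset)
        fix x assume "x \<in> U"
        then obtain \<alpha> where \<alpha>: "x \<in> c \<alpha>" "c \<alpha> \<subseteq> U"
          using base U by blast
        obtain \<gamma> where "\<alpha> \<in> underS \<kappa> \<gamma>"
          by (rule above_ex)
        then have "agree X f (f x) \<gamma> \<subseteq> c \<alpha>"
          using \<alpha> by (auto simp: agree_def f_def)
        then show "\<exists>\<gamma>. agree X f (f x) \<gamma> \<subseteq> U"
          using \<alpha> by blast
      qed
    next
      assume r: ?r
      show ?l
      proof (subst openin_subopen, intro ballI)
        fix x assume "x \<in> U"
        with r obtain \<gamma> where "agree X f (f x) \<gamma> \<subseteq> U" "x \<in> topspace X"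
          by blast
        then show "\<exists>T. openin X T \<and> x \<in> T \<and> T \<subseteq> U"
          using agree_open agree_self by (intro exI[of _ "agree X f (f x) \<gamma>"] conjI)
      qed
    qed
  qed
  then show ?thesis
    by (rule that)
qed

section \<open>Closedness of the set of codes\<close>

text \<open>
  Closedness of the set of codes in \<open>\<^sup>\<kappa>2\<close>, expressed through the points of the space.
\<close>

definition closed_image :: "'a topology \<Rightarrow> ('a \<Rightarrow> 'k \<Rightarrow> bool) \<Rightarrow> bool" where
  "closed_image X f \<longleftrightarrow> (\<forall>z. z \<notin> f ` topspace X \<longrightarrow> (\<exists>\<gamma>. agree X f z \<gamma> = {}))"

lemma closed_image_iff:
  "closed_image X f \<longleftrightarrow> closedin (bounded_topology \<kappa>) (f ` topspace X)"
proof -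
  have "{y. \<forall>\<alpha>\<in>underS \<kappa> \<gamma>. y \<alpha> = z \<alpha>} \<subseteq> - f ` topspace X \<longleftrightarrow> agree X f z \<gamma> = {}" for z \<gamma>
    by (auto simp: agree_def)
  then show ?thesis
    by (auto simp: closedin_def closed_image_def openin_bounded_topology Compl_eq_Diff_UNIV[symmetric])
qed

text \<open>
  For covers indexed by \<open>\<kappa>\<close>, the Lindelof property says by regularity of \<open>\<kappa>\<close> that an initial segment of
  the indices suffices.
\<close>

lemma Lindelof_indexed:
  fixes W :: "'k \<Rightarrow> 'a set"
  assumes "kappa_Lindelof \<kappa> X" and op: "\<And>\<alpha>. openin X (W \<alpha>)" and cover: "(\<Union>\<alpha>. W \<alpha>) = topspace X"
  obtains \<gamma> where "(\<Union>\<alpha>\<in>underS \<kappa> \<gamma>. W \<alpha>) = topspace X"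
proof -
  obtain \<V> where \<V>: "\<V> \<subseteq> range W" "|\<V>| <o \<kappa>" "\<Union>\<V> = topspace X"
    using assms(1)[unfolded kappa_Lindelof_def, rule_format, of "range W"] op cover by auto
  define g where "g = inv_into UNIV W"
  have g: "W (g V) = V" if "V \<in> \<V>" for V
    using \<V>(1) that unfolding g_def by (meson f_inv_into_f subsetD)
  obtain \<gamma> where \<gamma>: "\<And>\<alpha>. \<alpha> \<in> g ` \<V> \<Longrightarrow> (\<alpha>, \<gamma>) \<in> \<kappa>"
    using bounded_if_small[OF ordLess_image[OF \<V>(2)]] by blast
  obtain \<delta> where \<delta>: "\<gamma> \<in> underS \<kappa> \<delta>"
    by (rule above_ex)
  have "topspace X \<subseteq> (\<Union>\<alpha>\<in>underS \<kappa> \<delta>. W \<alpha>)"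
  proof
    fix x assume "x \<in> topspace X"
    then obtain V where V: "V \<in> \<V>" "x \<in> V"
      using \<V>(3) by blast
    moreover have "g V \<in> underS \<kappa> \<delta>"
      using \<gamma>[of "g V"] V \<delta> not_in_underS le_trans by (metis image_eqI)
    ultimately show "x \<in> (\<Union>\<alpha>\<in>underS \<kappa> \<delta>. W \<alpha>)"
      using g by blast
  qed
  then show ?thesis
    using cover by (intro that[of \<delta>]) blast
qed

text \<open>
  The analogue of \<open>compact subsets of Hausdorff spaces are closed\<close>: if \<open>z\<close> is not a code, the points
  that differ from \<open>z\<close> at \<open>\<alpha>\<close>, for \<open>\<alpha> < \<kappa>\<close>, cover the space, so all points differ from \<open>z\<close> below one \<open>\<gamma> < \<kappa>\<close>.
  This is the source of completeness, and of closedness in \<open>\<^sup>\<kappa>2\<close>.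
\<close>

lemma Lindelof_imp_closed_image:
  assumes "kappa_Lindelof \<kappa> X" and f: "coding X f"
  shows "closed_image X f"
  unfolding closed_image_def
proof (intro allI impI)
  fix z assume z: "z \<notin> f ` topspace X"
  define W where "W \<alpha> = {x \<in> topspace X. f x \<alpha> \<noteq> z \<alpha>}" for \<alpha>
  have op: "openin X (W \<alpha>)" for \<alpha>
    unfolding coding_openin[OF f]
  proof (intro conjI ballI)
    fix x assume x: "x \<in> W \<alpha>"
    obtain \<gamma> where "\<alpha> \<in> underS \<kappa> \<gamma>"
      by (rule above_ex)
    then have "agree X f (f x) \<gamma> \<subseteq> W \<alpha>"
      using x by (auto simp: agree_def W_def)
    then show "\<exists>\<gamma>. agree X f (f x) \<gamma> \<subseteq> W \<alpha>"
      by (rule exI)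
  qed (auto simp: W_def)
  have "\<exists>\<alpha>. f x \<alpha> \<noteq> z \<alpha>" if "x \<in> topspace X" for x
  proof -
    have "f x \<noteq> z"
      using z that by blast
    then show ?thesis
      by (simp add: fun_eq_iff)
  qed
  then have "(\<Union>\<alpha>. W \<alpha>) = topspace X"
    by (auto simp: W_def)
  then obtain \<gamma> where "(\<Union>\<alpha>\<in>underS \<kappa> \<gamma>. W \<alpha>) = topspace X"
    by (rule Lindelof_indexed[OF assms(1) op])
  then have "agree X f z \<gamma> = {}"
    by (auto simp: agree_def W_def)
  then show "\<exists>\<gamma>. agree X f z \<gamma> = {}"
    by (rule exI)
qed

section \<open>Metrics with values in a group of degree \<open>\<kappa>\<close>\<close>

text \<open>
  As the coinitiality of the positive cone is \<open>\<kappa>\<close>, fewer than \<open>\<kappa>\<close> positive elements are never coinitial.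
\<close>

lemma Deg_lower_bound:
  fixes A :: "'g::linordered_ab_group_add set"
  assumes "Deg_eq TYPE('g) \<kappa>" and "|A| <o \<kappa>" and "\<And>a. a \<in> A \<Longrightarrow> 0 < a"
  obtains s where "0 < s" "\<And>a. a \<in> A \<Longrightarrow> s < a"
proof -
  have "\<not> coinitial_in {\<epsilon>::'g. 0 < \<epsilon>} A"
    using assms(1,2) not_ordLess_ordLeq unfolding Deg_eq_def coinitiality_eq_def by blast
  then obtain s where "0 < s" "\<forall>a\<in>A. \<not> a \<le> s"
    using assms(3) unfolding coinitial_in_def by blast
  then show ?thesis
    using that by (meson not_le)
qed

lemma Deg_coinitial:
  assumes "Deg_eq TYPE('g::linordered_ab_group_add) \<kappa>"
  obtains A :: "'g::linordered_ab_group_add set"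
    where "|A| =o \<kappa>" "\<forall>a\<in>A. 0 < a" "\<forall>\<epsilon>>0. \<exists>a\<in>A. a \<le> \<epsilon>"
proof -
  obtain A :: "'g set" where "coinitial_in {\<epsilon>. 0 < \<epsilon>} A" "|A| =o \<kappa>"
    using assms unfolding Deg_eq_def coinitiality_eq_def by blast
  then show ?thesis
    by (intro that[of A]) (auto simp: coinitial_in_def)
qed

text \<open>
  A coinitial family of size \<open>\<kappa>\<close> is made decreasing by recursion: at stage \<open>\<gamma>\<close> only fewer than \<open>\<kappa>\<close>
  positive elements have to be undercut.
\<close>

lemma Deg_decreasing_sequence:
  assumes deg: "Deg_eq TYPE('g::linordered_ab_group_add) \<kappa>"
  obtains r :: "'k \<Rightarrow> 'g::linordered_ab_group_add"
    where "\<forall>\<gamma>. 0 < r \<gamma>" "\<forall>\<gamma> \<delta>. (\<gamma>, \<delta>) \<in> \<kappa> \<longrightarrow> r \<delta> \<le> r \<gamma>" "\<forall>\<epsilon>>0. \<exists>\<gamma>. r \<gamma> < \<epsilon>"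
proof -
  obtain A :: "'g set" where A: "|A| =o \<kappa>" "\<forall>a\<in>A. 0 < a" "\<forall>\<epsilon>>0. \<exists>a\<in>A. a \<le> \<epsilon>"
    by (rule Deg_coinitial[OF deg])
  have "A \<noteq> {}"
  proof
    assume "A = {}"
    then have "|A| <o \<kappa>"
      by (simp add: ordLess_finite)
    then show False
      using A(1) not_ordLess_ordIso by blast
  qed
  then obtain a :: "'k \<Rightarrow> 'g" where a: "range a = A"
    using enumeration A(1) ordIso_iff_ordLeq by metis
  define P where "P f \<gamma> s \<longleftrightarrow> 0 < s \<and> s < a \<gamma> \<and> (\<forall>\<beta>\<in>underS \<kappa> \<gamma>. s < f \<beta>)"
    for f :: "'k \<Rightarrow> 'g" and \<gamma> and s
  have "\<exists>r. \<forall>\<gamma>. P r \<gamma> (r \<gamma>)"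
  proof (rule dependent_wf_choice[OF wf_strict])
    show "P f \<gamma> s = P g \<gamma> s" if "\<And>\<beta>. (\<beta>, \<gamma>) \<in> \<kappa> - Id \<Longrightarrow> f \<beta> = g \<beta>" for f g \<gamma> s
      using that by (auto simp: P_def underS_def)
    show "\<exists>s. P f \<gamma> s" if f: "\<And>\<beta>. (\<beta>, \<gamma>) \<in> \<kappa> - Id \<Longrightarrow> P f \<beta> (f \<beta>)" for f \<gamma>
    proof -
      have "|{a \<gamma>} \<union> f ` underS \<kappa> \<gamma>| <o \<kappa>"
        by (intro ordLess_Un ordLess_finite ordLess_image ordLess_underS) simp
      moreover have "0 < b" if "b \<in> {a \<gamma>} \<union> f ` underS \<kappa> \<gamma>" for b
        using that f A(2) a by (auto simp: P_def underS_def)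
      ultimately obtain s where "0 < s" "\<And>b. b \<in> {a \<gamma>} \<union> f ` underS \<kappa> \<gamma> \<Longrightarrow> s < b"
        using Deg_lower_bound[OF deg] by blast
      then show ?thesis
        by (intro exI[of _ s]) (auto simp: P_def)
    qed
  qed
  then obtain r where r: "\<And>\<gamma>. 0 < r \<gamma>" "\<And>\<gamma>. r \<gamma> < a \<gamma>" "\<And>\<gamma> \<beta>. \<beta> \<in> underS \<kappa> \<gamma> \<Longrightarrow> r \<gamma> < r \<beta>"
    unfolding P_def by auto
  show ?thesis
  proof (intro that[of r] allI impI)
    show "r \<delta> \<le> r \<gamma>" if "(\<gamma>, \<delta>) \<in> \<kappa>" for \<gamma> \<delta>
      using r(3)[of \<gamma> \<delta>] that by (cases "\<gamma> = \<delta>") (auto simp: underS_def)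
    show "\<exists>\<gamma>. r \<gamma> < \<epsilon>" if \<epsilon>: "0 < \<epsilon>" for \<epsilon>
    proof -
      obtain \<gamma> where "a \<gamma> \<le> \<epsilon>"
        using A(3) \<epsilon> a by blast
      then have "r \<gamma> < \<epsilon>"
        using r(2)[of \<gamma>] by simp
      then show ?thesis ..
    qed
  qed (rule r(1))
qed

text \<open>
  Fewer than \<open>\<kappa>\<close> balls around a point have a common smaller ball around it.
\<close>

lemma G_metrizable_imp_additive:
  assumes deg: "Deg_eq TYPE('g::linordered_ab_group_add) \<kappa>" and "G_metrizable TYPE('g::linordered_ab_group_add) X"
  shows "kappa_additive \<kappa> X"
proof -
  obtain d :: "'a \<Rightarrow> 'a \<Rightarrow> 'g" where d: "G_metric_on (topspace X) d" "G_topology (topspace X) d = X"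
    using assms(2) by (auto simp: G_metrizable_def compatible_G_metric_def)
  have op: "openin X U \<longleftrightarrow>
      U \<subseteq> topspace X \<and> (\<forall>x\<in>U. \<exists>\<epsilon>>0. {y \<in> topspace X. d x y < \<epsilon>} \<subseteq> U)" for U
    using openin_G_topology[OF d(1), of U] d(2) by simp
  show ?thesis
    unfolding kappa_additive_def
  proof (intro allI impI)
    fix \<U> assume \<U>: "\<U> \<noteq> {} \<and> |\<U>| <o \<kappa> \<and> (\<forall>U\<in>\<U>. openin X U)"
    show "openin X (\<Inter>\<U>)"
      unfolding op
    proof (intro conjI ballI)
      show "\<Inter>\<U> \<subseteq> topspace X"
        using \<U> openin_subset by blast
      fix x assume x: "x \<in> \<Inter>\<U>"
      have "\<forall>U\<in>\<U>. \<exists>\<epsilon>>0. {y \<in> topspace X. d x y < \<epsilon>} \<subseteq> U"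
        using \<U> x op by (meson InterE)
      then obtain \<epsilon> where \<epsilon>: "\<And>U. U \<in> \<U> \<Longrightarrow> 0 < \<epsilon> U"
          "\<And>U. U \<in> \<U> \<Longrightarrow> {y \<in> topspace X. d x y < \<epsilon> U} \<subseteq> U"
        by metis
      obtain s where "0 < s" and s: "\<And>e. e \<in> \<epsilon> ` \<U> \<Longrightarrow> s < e"
        using Deg_lower_bound[OF deg ordLess_image[of \<U> \<epsilon>]] \<U> \<epsilon>(1) by blast
      have "{y \<in> topspace X. d x y < s} \<subseteq> \<Inter>\<U>"
      proof (rule Inter_greatest)
        fix U assume "U \<in> \<U>"
        then have "{y \<in> topspace X. d x y < s} \<subseteq> {y \<in> topspace X. d x y < \<epsilon> U}"
          using s[of "\<epsilon> U"] by auto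
        then show "{y \<in> topspace X. d x y < s} \<subseteq> U"
          using \<epsilon>(2)[OF \<open>U \<in> \<U>\<close>] by simp
      qed
      then show "\<exists>\<epsilon>>0. {y \<in> topspace X. d x y < \<epsilon>} \<subseteq> \<Inter>\<U>"
        using \<open>0 < s\<close> by (intro exI conjI)
    qed
  qed
qed

text \<open>
  For each member of a coinitial set of radii, fewer than \<open>\<kappa>\<close> balls of this radius cover the space.  By
  the triangle inequality all these balls together form a base.
\<close>

lemma Lindelof_G_metrizable_imp_weight_le:
  assumes deg: "Deg_eq TYPE('g::linordered_ab_group_add) \<kappa>" and "G_metrizable TYPE('g::linordered_ab_group_add) X"
    and Lindelof: "kappa_Lindelof \<kappa> X"
  shows "weight_le X \<kappa>"
proof -
  obtain d :: "'a \<Rightarrow> 'a \<Rightarrow> 'g" where d: "G_metric_on (topspace X) d" "G_topology (topspace X) d = X"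
    using assms(2) by (auto simp: G_metrizable_def compatible_G_metric_def)
  have sym: "d x y = d y x" and zero: "d x x = 0" and tri: "d x z \<le> d x y + d y z"
    if "x \<in> topspace X" "y \<in> topspace X" "z \<in> topspace X" for x y z
    using d(1) that unfolding G_metric_on_def by blast+
  have op: "openin X U \<longleftrightarrow>
      U \<subseteq> topspace X \<and> (\<forall>x\<in>U. \<exists>\<epsilon>>0. {y \<in> topspace X. d x y < \<epsilon>} \<subseteq> U)" for U
    using openin_G_topology[OF d(1), of U] d(2) by simp
  define ball where "ball x a = {y \<in> topspace X. d x y < a}" for x a
  have ball_open: "openin X (ball x a)" if "x \<in> topspace X" "0 < a" for x a
  proof -
    have "openin (G_topology (topspace X) d) (ball x a)"
      unfolding G_topology_def ball_def using that
      by (intro topology_generated_by_Basis CollectI exI conjI) auto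
    then show ?thesis
      by (simp add: d(2))
  qed
  obtain A :: "'g set" where A: "|A| =o \<kappa>" "\<forall>a\<in>A. 0 < a" "\<forall>\<epsilon>>0. \<exists>a\<in>A. a \<le> \<epsilon>"
    by (rule Deg_coinitial[OF deg])
  have "\<exists>\<V>. \<V> \<subseteq> (\<lambda>x. ball x a) ` topspace X \<and> |\<V>| <o \<kappa> \<and> \<Union>\<V> = topspace X" if "a \<in> A" for a
  proof (rule Lindelof[unfolded kappa_Lindelof_def, rule_format], intro conjI ballI)
    show "openin X U" if "U \<in> (\<lambda>x. ball x a) ` topspace X" for U
      using that ball_open A(2) \<open>a \<in> A\<close> by blast
    have "x \<in> ball x a" if "x \<in> topspace X" for x
      using that zero A(2) \<open>a \<in> A\<close> by (simp add: ball_def)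
    then show "\<Union> ((\<lambda>x. ball x a) ` topspace X) = topspace X"
      by (auto simp: ball_def)
  qed
  then obtain \<V> where \<V>: "\<And>a. a \<in> A \<Longrightarrow> \<V> a \<subseteq> (\<lambda>x. ball x a) ` topspace X"
    "\<And>a. a \<in> A \<Longrightarrow> |\<V> a| <o \<kappa>" "\<And>a. a \<in> A \<Longrightarrow> \<Union>(\<V> a) = topspace X"
    by metis
  show ?thesis
    unfolding weight_le_def
  proof (intro exI conjI allI impI ballI)
    show "|\<Union>a\<in>A. \<V> a| \<le>o \<kappa>"
      using A(1) \<V>(2) by (intro ordLeq_UNION ordIso_imp_ordLeq ordLess_imp_ordLeq)
    show "openin X B" if "B \<in> (\<Union>a\<in>A. \<V> a)" for B
      using that \<V>(1) ball_open A(2) by blast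
    fix U x assume U: "openin X U \<and> x \<in> U"
    then obtain \<epsilon> where "0 < \<epsilon>" and \<epsilon>: "ball x \<epsilon> \<subseteq> U"
      unfolding op ball_def by blast
    obtain \<delta> where \<delta>: "0 < \<delta>" "\<delta> < \<epsilon>"
      using Deg_lower_bound[OF deg ordLess_finite, of "{\<epsilon>}"] \<open>0 < \<epsilon>\<close> by auto
    \<comment> \<open>The group need not be divisible; the smaller one of \<open>\<delta>\<close> and \<open>\<epsilon> - \<delta>\<close> replaces half of \<open>\<epsilon>\<close>.\<close>
    obtain a where a: "a \<in> A" "a \<le> min \<delta> (\<epsilon> - \<delta>)"
      using A(3)[rule_format, of "min \<delta> (\<epsilon> - \<delta>)"] \<delta> by auto
    have half: "a + a \<le> \<epsilon>"
      using add_mono[of a \<delta> a "\<epsilon> - \<delta>"] a(2) by simp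
    have x: "x \<in> topspace X"
      using U openin_subset by blast
    then obtain B where B: "B \<in> \<V> a" "x \<in> B"
      using \<V>(3)[OF a(1)] by blast
    then obtain y where y: "y \<in> topspace X" "B = ball y a"
      using \<V>(1)[OF a(1)] by blast
    have "B \<subseteq> ball x \<epsilon>"
    proof
      fix z assume "z \<in> B"
      then have z: "z \<in> topspace X" "d y z < a"
        by (auto simp: y(2) ball_def)
      have "d x y < a"
        using B(2) sym[of x y y] x y by (simp add: ball_def)
      have "d x z \<le> d x y + d y z"
        using tri x y(1) z(1) by blast
      also have "\<dots> < a + a"
        using \<open>d x y < a\<close> z(2) by (rule add_strict_mono)
      finally show "z \<in> ball x \<epsilon>"
        using half z(1) by (simp add: ball_def)
    qed
    then show "\<exists>B\<in>(\<Union>a\<in>A. \<V> a). x \<in> B \<and> B \<subseteq> U"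
      using B a(1) \<epsilon> by (intro bexI[of _ B]) auto
  qed
qed

definition split_point :: "('k \<Rightarrow> bool) \<Rightarrow> ('k \<Rightarrow> bool) \<Rightarrow> 'k" where
  "split_point x y = (SOME \<alpha>. x \<alpha> \<noteq> y \<alpha> \<and> (\<forall>\<beta>\<in>underS \<kappa> \<alpha>. x \<beta> = y \<beta>))"

text \<open>
  The usual ultrametric on a space of branches: two branches are the closer, the later they split.
  The radii \<open>r\<close> will be a decreasing coinitial sequence of positive elements.
\<close>

definition split_dist ::
    "('k \<Rightarrow> 'g::linordered_ab_group_add) \<Rightarrow> ('k \<Rightarrow> bool) \<Rightarrow> ('k \<Rightarrow> bool) \<Rightarrow> 'g" where
  "split_dist r x y = (if x = y then 0 else r (split_point x y))"

lemma split_point: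
  assumes "x \<noteq> y"
  shows "x (split_point x y) \<noteq> y (split_point x y)"
    and "\<beta> \<in> underS \<kappa> (split_point x y) \<Longrightarrow> x \<beta> = y \<beta>"
proof -
  obtain \<alpha>0 where "\<alpha>0 \<in> {\<alpha>. x \<alpha> \<noteq> y \<alpha>}"
    using assms by auto
  then obtain \<alpha> where "\<alpha> \<in> {\<alpha>. x \<alpha> \<noteq> y \<alpha>}" "\<And>\<beta>. (\<beta>, \<alpha>) \<in> \<kappa> - Id \<Longrightarrow> \<beta> \<notin> {\<alpha>. x \<alpha> \<noteq> y \<alpha>}"
    by (rule wfE_min[OF wf_strict]) (rule that; blast)
  then have "x \<alpha> \<noteq> y \<alpha> \<and> (\<forall>\<beta>\<in>underS \<kappa> \<alpha>. x \<beta> = y \<beta>)"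
    by (auto simp: underS_def)
  then have "x (split_point x y) \<noteq> y (split_point x y) \<and>
      (\<forall>\<beta>\<in>underS \<kappa> (split_point x y). x \<beta> = y \<beta>)"
    unfolding split_point_def by (rule someI)
  then show "x (split_point x y) \<noteq> y (split_point x y)"
    "\<beta> \<in> underS \<kappa> (split_point x y) \<Longrightarrow> x \<beta> = y \<beta>"
    by auto
qed

lemma split_point_commute: "split_point x y = split_point y x"
  unfolding split_point_def by metis

context
  fixes r :: "'k \<Rightarrow> 'g::linordered_ab_group_add"
  assumes pos: "\<And>\<gamma>. 0 < r \<gamma>"
    and decreasing: "\<And>\<gamma> \<delta>. (\<gamma>, \<delta>) \<in> \<kappa> \<Longrightarrow> r \<delta> \<le> r \<gamma>"
    and coinitial: "\<And>\<epsilon>. 0 < \<epsilon> \<Longrightarrow> \<exists>\<gamma>. r \<gamma> < \<epsilon>"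
begin

lemma split_dist_le:
  assumes "\<And>\<alpha>. \<alpha> \<in> underS \<kappa> \<gamma> \<Longrightarrow> x \<alpha> = y \<alpha>"
  shows "split_dist r x y \<le> r \<gamma>"
proof (cases "x = y")
  case False
  then have "split_point x y \<notin> underS \<kappa> \<gamma>"
    using assms split_point(1) by blast
  then show ?thesis
    using False decreasing by (simp add: split_dist_def not_in_underS)
qed (simp add: split_dist_def pos less_imp_le)

lemma split_dist_ge: "x \<alpha> \<noteq> y \<alpha> \<Longrightarrow> r \<alpha> \<le> split_dist r x y"
  using split_point(2)[of x y \<alpha>] decreasing not_in_underS by (auto simp: split_dist_def)

lemma split_dist_less_imp_agree:
  assumes "split_dist r x y < r \<gamma>" and "\<alpha> \<in> underS \<kappa> \<gamma>"
  shows "x \<alpha> = y \<alpha>"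
proof (rule ccontr)
  assume "x \<alpha> \<noteq> y \<alpha>"
  moreover have "r \<gamma> \<le> r \<alpha>"
    using assms(2) by (intro decreasing) (simp add: underS_def)
  ultimately show False
    using split_dist_ge[of x \<alpha> y] assms(1) by simp
qed

lemma G_metric_on_split_dist:
  assumes "inj_on f M"
  shows "G_metric_on M (\<lambda>x y. split_dist r (f x) (f y))"
proof -
  have nonneg: "0 \<le> split_dist r x y" and zero: "split_dist r x y = 0 \<longleftrightarrow> x = y" for x y
    using pos[of "split_point x y"] by (auto simp: split_dist_def)
  have tri: "split_dist r x z \<le> split_dist r x y + split_dist r y z" for x y z
  proof (cases "x = z")
    case True
    then show ?thesis
      using nonneg by (simp add: split_dist_def)
  next
    case False
    define \<alpha> where "\<alpha> = split_point x z"
    have d: "split_dist r x z = r \<alpha>" and "x \<alpha> \<noteq> z \<alpha>"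
      using False split_point(1) by (auto simp: split_dist_def \<alpha>_def)
    then have "x \<alpha> \<noteq> y \<alpha> \<or> y \<alpha> \<noteq> z \<alpha>"
      by auto
    then have "r \<alpha> \<le> split_dist r x y \<or> r \<alpha> \<le> split_dist r y z"
      using split_dist_ge[of x \<alpha> y] split_dist_ge[of y \<alpha> z] by blast
    then show ?thesis
      unfolding d using add_increasing[OF nonneg] add_increasing2[OF nonneg] by (elim disjE) simp_all
  qed
  have sym: "split_dist r x y = split_dist r y x" for x y
    by (simp add: split_dist_def split_point_commute)
  show ?thesis
    unfolding G_metric_on_def
    by (intro conjI ballI nonneg tri) (auto simp: zero inj_on_eq_iff[OF assms] intro: sym)
qed

lemma compatible_split_dist:
  assumes f: "coding X f"
  shows "compatible_G_metric X (\<lambda>x y. split_dist r (f x) (f y))"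
proof -
  let ?d = "\<lambda>x y. split_dist r (f x) (f y)"
  have metric: "G_metric_on (topspace X) ?d"
    by (rule G_metric_on_split_dist[OF coding_inj[OF f]])
  have ball: "{y \<in> topspace X. ?d x y < r \<gamma>} \<subseteq> agree X f (f x) \<gamma>" for x \<gamma>
    using split_dist_less_imp_agree by (fastforce simp: agree_def)
  have agree: "agree X f (f x) \<gamma> \<subseteq> {y \<in> topspace X. ?d x y < \<epsilon>}" if "r \<gamma> < \<epsilon>" for x \<gamma> \<epsilon>
  proof
    fix y assume y: "y \<in> agree X f (f x) \<gamma>"
    then have "?d x y \<le> r \<gamma>"
      by (intro split_dist_le) (simp add: agree_def)
    then show "y \<in> {y \<in> topspace X. ?d x y < \<epsilon>}"
      using y that by (simp add: agree_def)
  qed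
  have "openin (G_topology (topspace X) ?d) U \<longleftrightarrow> openin X U" for U
    unfolding openin_G_topology[OF metric] coding_openin[OF f]
  proof (intro conj_cong ball_cong refl iffI)
    fix x assume "\<exists>\<epsilon>>0. {y \<in> topspace X. ?d x y < \<epsilon>} \<subseteq> U"
    then obtain \<epsilon> where \<epsilon>: "0 < \<epsilon>" "{y \<in> topspace X. ?d x y < \<epsilon>} \<subseteq> U"
      by blast
    obtain \<gamma> where "r \<gamma> < \<epsilon>"
      using coinitial[OF \<epsilon>(1)] ..
    then have "agree X f (f x) \<gamma> \<subseteq> U"
      using agree \<epsilon>(2) by (meson subset_trans)
    then show "\<exists>\<gamma>. agree X f (f x) \<gamma> \<subseteq> U" ..
  next
    fix x assume "\<exists>\<gamma>. agree X f (f x) \<gamma> \<subseteq> U"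
    then obtain \<gamma> where "agree X f (f x) \<gamma> \<subseteq> U" ..
    then have "{y \<in> topspace X. ?d x y < r \<gamma>} \<subseteq> U"
      using ball by (meson subset_trans)
    then show "\<exists>\<epsilon>>0. {y \<in> topspace X. ?d x y < \<epsilon>} \<subseteq> U"
      using pos by (intro exI conjI)
  qed
  then have "G_topology (topspace X) ?d = X"
    by (simp add: topology_eq)
  then show ?thesis
    using metric by (simp add: compatible_G_metric_def)
qed

text \<open>
  Every coordinate of the codes along a Cauchy sequence is eventually constant, and by regularity of \<open>\<kappa>\<close>
  fewer than \<open>\<kappa>\<close> coordinates stabilise simultaneously.  Hence the codes converge in \<open>\<^sup>\<kappa>2\<close>, and their
  limit is a code since the set of codes is closed.
\<close>

lemma Cauchy_complete_split_dist:
  assumes closed: "closed_image X f"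
  shows "Cauchy_complete_on \<kappa> (topspace X) (\<lambda>x y. split_dist r (f x) (f y))"
  unfolding Cauchy_complete_on_def
proof (intro allI impI, elim conjE)
  fix x :: "'k \<Rightarrow> 'a"
  assume x: "range x \<subseteq> topspace X" and Cauchy: "G_Cauchy \<kappa> (\<lambda>x y. split_dist r (f x) (f y)) x"
  have "\<exists>\<delta> b. \<forall>\<beta>. (\<delta>, \<beta>) \<in> \<kappa> \<longrightarrow> f (x \<beta>) \<alpha> = b" for \<alpha>
  proof -
    obtain \<gamma> where \<gamma>: "\<alpha> \<in> underS \<kappa> \<gamma>"
      by (rule above_ex)
    obtain \<delta> where \<delta>: "\<And>\<beta>. (\<delta>, \<beta>) \<in> \<kappa> \<Longrightarrow> split_dist r (f (x \<beta>)) (f (x \<delta>)) < r \<gamma>"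
      using Cauchy pos[of \<gamma>] le_refl unfolding G_Cauchy_def by meson
    have "\<forall>\<beta>. (\<delta>, \<beta>) \<in> \<kappa> \<longrightarrow> f (x \<beta>) \<alpha> = f (x \<delta>) \<alpha>"
      using split_dist_less_imp_agree[OF \<delta> \<gamma>] by blast
    then show ?thesis
      by (intro exI)
  qed
  then obtain \<delta> z where z: "\<And>\<alpha> \<beta>. (\<delta> \<alpha>, \<beta>) \<in> \<kappa> \<Longrightarrow> f (x \<beta>) \<alpha> = z \<alpha>"
    by metis
  have tail: "\<exists>\<delta>'. \<forall>\<beta>. (\<delta>', \<beta>) \<in> \<kappa> \<longrightarrow> x \<beta> \<in> agree X f z \<gamma>" for \<gamma>
  proof -
    obtain \<delta>' where \<delta>': "\<And>\<alpha>. \<alpha> \<in> \<delta> ` underS \<kappa> \<gamma> \<Longrightarrow> (\<alpha>, \<delta>') \<in> \<kappa>"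
      using bounded_if_small[OF ordLess_image[OF ordLess_underS]] by blast
    have "x \<beta> \<in> agree X f z \<gamma>" if "(\<delta>', \<beta>) \<in> \<kappa>" for \<beta>
      unfolding agree_def
    proof (intro CollectI conjI ballI)
      show "f (x \<beta>) \<alpha> = z \<alpha>" if "\<alpha> \<in> underS \<kappa> \<gamma>" for \<alpha>
        using z le_trans[OF \<delta>' \<open>(\<delta>', \<beta>) \<in> \<kappa>\<close>] that by blast
    qed (use x in blast)
    then show ?thesis
      by blast
  qed
  have "z \<in> f ` topspace X"
  proof (rule ccontr)
    assume "z \<notin> f ` topspace X"
    then obtain \<gamma> where "agree X f z \<gamma> = {}"
      using closed unfolding closed_image_def by blast
    then show False
      using tail[of \<gamma>] le_refl by blast
  qed
  then obtain l where l: "l \<in> topspace X" "z = f l"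
    by blast
  have "G_converges \<kappa> (\<lambda>x y. split_dist r (f x) (f y)) x l"
    unfolding G_converges_def
  proof (intro allI impI)
    fix \<epsilon> :: 'g assume "0 < \<epsilon>"
    then obtain \<gamma> where \<gamma>: "r \<gamma> < \<epsilon>"
      using coinitial by blast
    obtain \<delta>' where \<delta>': "\<And>\<beta>. (\<delta>', \<beta>) \<in> \<kappa> \<Longrightarrow> x \<beta> \<in> agree X f z \<gamma>"
      using tail[of \<gamma>] by blast
    have "split_dist r (f (x \<beta>)) (f l) < \<epsilon>" if "(\<delta>', \<beta>) \<in> \<kappa>" for \<beta>
      using split_dist_le[of \<gamma> "f (x \<beta>)" "f l"] \<delta>'[OF that] \<gamma> l(2) by (simp add: agree_def)
    then show "\<exists>\<delta>'. \<forall>\<beta>. (\<delta>', \<beta>) \<in> \<kappa> \<longrightarrow> split_dist r (f (x \<beta>)) (f l) < \<epsilon>"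
      by blast
  qed
  then show "\<exists>l\<in>topspace X. G_converges \<kappa> (\<lambda>x y. split_dist r (f x) (f y)) x l"
    using l(1) by blast
qed

end

lemma coding_imp_G_Polish:
  assumes "Deg_eq TYPE('g::linordered_ab_group_add) \<kappa>" and "weight_le X \<kappa>"
    and "coding X f" and "closed_image X f"
  shows "G_Polish \<kappa> TYPE('g::linordered_ab_group_add) X"
proof -
  obtain r :: "'k \<Rightarrow> 'g" where "\<forall>\<gamma>. 0 < r \<gamma>" "\<forall>\<gamma> \<delta>. (\<gamma>, \<delta>) \<in> \<kappa> \<longrightarrow> r \<delta> \<le> r \<gamma>"
    "\<forall>\<epsilon>>0. \<exists>\<gamma>. r \<gamma> < \<epsilon>"
    by (rule Deg_decreasing_sequence[OF assms(1)])
  note r = this[rule_format]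
  show ?thesis
    unfolding G_Polish_def
    using compatible_split_dist[OF r assms(3)] Cauchy_complete_split_dist[OF r assms(4)] assms(2)
    by blast
qed


section \<open>The strong fair Choquet game\<close>

text \<open>
  Player II answers every move \<open>(U, x)\<close> by a set that is clopen in the whole space, not merely in the
  current position: complements of such answers are available for open covers of the space.
\<close>

definition clopen_answer :: "'a topology \<Rightarrow> 'a set \<times> 'a \<Rightarrow> 'a set" where
  "clopen_answer X m = (SOME C. openin X C \<and> closedin X C \<and> snd m \<in> C \<and> C \<subseteq> fst m)"

text \<open>
  The current round is the length of the position, which is recovered from the domain of the record of
  the moves of I.
\<close>

definition clopen_strategy :: "'a topology \<Rightarrow> ('k, 'a) strategy" where
  "clopen_strategy X P Q = clopen_answer X (the (P (THE \<alpha>. dom P = under \<kappa> \<alpha>)))"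

lemma clopen_answer:
  assumes "kappa_additive \<kappa> X" and "regular_space X" and "openin X (fst m)" and "snd m \<in> fst m"
  shows "openin X (clopen_answer X m)" "closedin X (clopen_answer X m)"
    "snd m \<in> clopen_answer X m" "clopen_answer X m \<subseteq> fst m"
proof -
  have "\<exists>C. openin X C \<and> closedin X C \<and> snd m \<in> C \<and> C \<subseteq> fst m"
    using clopen_neighbourhood[OF assms] by metis
  then show "openin X (clopen_answer X m)" "closedin X (clopen_answer X m)"
    "snd m \<in> clopen_answer X m" "clopen_answer X m \<subseteq> fst m"
    unfolding clopen_answer_def by (metis (mono_tags, lifting) someI_ex)+
qed

lemma under_inject: "under \<kappa> \<alpha> = under \<kappa> \<beta> \<longleftrightarrow> \<alpha> = \<beta>"
proof
  assume eq: "under \<kappa> \<alpha> = under \<kappa> \<beta>"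
  have "\<alpha> \<in> under \<kappa> \<alpha>" "\<beta> \<in> under \<kappa> \<beta>"
    by (simp_all add: under_def)
  with eq have "\<alpha> \<in> under \<kappa> \<beta>" "\<beta> \<in> under \<kappa> \<alpha>"
    by simp_all
  then show "\<alpha> = \<beta>"
    by (auto simp: under_def intro: le_antisym)
qed simp

lemma follows_clopen_strategy:
  "follows \<kappa> (clopen_strategy X) p V \<alpha> \<longleftrightarrow> V \<alpha> = clopen_answer X (p \<alpha>)"
proof -
  have "dom ((Some \<circ> p) |` under \<kappa> \<alpha>) = under \<kappa> \<alpha>"
    by auto
  then have "(THE \<beta>. dom ((Some \<circ> p) |` under \<kappa> \<alpha>) = under \<kappa> \<beta>) = \<alpha>"
    by (simp add: under_inject)
  moreover have "((Some \<circ> p) |` under \<kappa> \<alpha>) \<alpha> = Some (p \<alpha>)"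
    by (simp add: under_def)
  ultimately show ?thesis
    by (simp add: follows_def clopen_strategy_def)
qed

lemma openin_game_rest:
  assumes "kappa_additive \<kappa> X" and "\<And>\<beta>. \<beta> \<in> underS \<kappa> \<alpha> \<Longrightarrow> openin X (V \<beta>)"
  shows "openin X (game_rest \<kappa> X V \<alpha>)"
  unfolding game_rest_def using assms by (intro additive_INT ordLess_underS)

text \<open>
  Induction on the round: if all earlier answers are open, the current position is open by
  additivity, so the relatively open move of I is open in the whole space and has a clopen answer.
\<close>

lemma clopen_strategy_position:
  assumes X: "kappa_additive \<kappa> X" "regular_space X"
    and "\<And>\<beta>. \<beta> \<in> under \<kappa> \<alpha> \<Longrightarrow> legal_I \<kappa> X p V \<beta> \<and> follows \<kappa> (clopen_strategy X) p V \<beta>"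
  shows "openin X (V \<alpha>) \<and> closedin X (V \<alpha>) \<and> legal_II \<kappa> X p V \<alpha>"
  using wf_strict assms(3)
proof (induction \<alpha> rule: wf_induct_rule)
  case (less \<alpha>)
  have "openin X (V \<beta>)" if "\<beta> \<in> underS \<kappa> \<alpha>" for \<beta>
  proof -
    have "(\<beta>, \<alpha>) \<in> \<kappa> - Id"
      using that by (simp add: underS_def)
    moreover have "legal_I \<kappa> X p V \<gamma> \<and> follows \<kappa> (clopen_strategy X) p V \<gamma>"
      if "\<gamma> \<in> under \<kappa> \<beta>" for \<gamma>
      using less.prems[of \<gamma>] that \<open>\<beta> \<in> underS \<kappa> \<alpha>\<close> le_trans by (auto simp: under_def underS_def)
    ultimately show ?thesis
      using less.IH by blast
  qed
  then have rest: "openin X (game_rest \<kappa> X V \<alpha>)"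
    using X(1) by (intro openin_game_rest)
  have "legal_I \<kappa> X p V \<alpha>" and V: "V \<alpha> = clopen_answer X (p \<alpha>)"
    using less.prems[of \<alpha>] by (auto simp: under_def follows_clopen_strategy)
  then have p: "openin X (fst (p \<alpha>))" "fst (p \<alpha>) \<subseteq> game_rest \<kappa> X V \<alpha>" "snd (p \<alpha>) \<in> fst (p \<alpha>)"
    using rest by (auto simp: legal_I_def openin_open_subtopology)
  note answer = clopen_answer[OF X p(1,3), folded V]
  then show ?case
    using rest p(2) by (auto simp: legal_II_def openin_open_subtopology)
qed

text \<open>
  If the answers of II had empty intersection, their complements would be an open cover, and then
  already the answers before some round \<open>\<gamma> < \<kappa>\<close> would have empty intersection; but I has chosen a point
  of this intersection in round \<open>\<gamma>\<close>.
\<close>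

lemma Lindelof_additive_imp_winning_strategy:
  assumes Lindelof: "kappa_Lindelof \<kappa> X" and X: "kappa_additive \<kappa> X" "regular_space X"
  shows "winning_strategy_II \<kappa> X (clopen_strategy X)"
  unfolding winning_strategy_II_def
proof (intro conjI allI impI)
  fix p V \<alpha>
  assume "\<forall>\<beta>\<in>under \<kappa> \<alpha>. legal_I \<kappa> X p V \<beta> \<and> follows \<kappa> (clopen_strategy X) p V \<beta>"
  then show "legal_II \<kappa> X p V \<alpha>"
    using clopen_strategy_position[OF X] by blast
next
  fix p :: "'k \<Rightarrow> 'a set \<times> 'a" and V
  assume run: "\<forall>\<alpha>. legal_I \<kappa> X p V \<alpha> \<and> legal_II \<kappa> X p V \<alpha> \<and> follows \<kappa> (clopen_strategy X) p V \<alpha>"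
  have closed: "closedin X (V \<alpha>)" for \<alpha>
    using clopen_strategy_position[OF X, of \<alpha> p V] run by blast
  show "(\<Inter>\<alpha>. V \<alpha>) \<noteq> {}"
  proof
    assume empty: "(\<Inter>\<alpha>. V \<alpha>) = {}"
    have "openin X (topspace X - V \<alpha>)" for \<alpha>
      using closed by (simp add: openin_diff)
    moreover have "(\<Union>\<alpha>. topspace X - V \<alpha>) = topspace X"
      using empty by auto
    ultimately obtain \<gamma> where \<gamma>: "(\<Union>\<alpha>\<in>underS \<kappa> \<gamma>. topspace X - V \<alpha>) = topspace X"
      by (rule Lindelof_indexed[OF Lindelof])
    have "legal_I \<kappa> X p V \<gamma>"
      using run by blast
    then have "snd (p \<gamma>) \<in> game_rest \<kappa> X V \<gamma>"
      unfolding legal_I_def using openin_subset[of _ "fst (p \<gamma>)"] by fastforce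
    then show False
      using \<gamma> by (auto simp: game_rest_def)
  qed
qed

section \<open>Weakly compact cardinals\<close>

text \<open>
  Fewer than \<open>\<kappa>\<close> stages below \<open>\<kappa>\<close> are bounded, by regularity of \<open>\<kappa>\<close>.
\<close>

lemma coding_imp_additive:
  assumes f: "coding X f"
  shows "kappa_additive \<kappa> X"
  unfolding kappa_additive_def
proof (intro allI impI)
  fix \<U> assume \<U>: "\<U> \<noteq> {} \<and> |\<U>| <o \<kappa> \<and> (\<forall>U\<in>\<U>. openin X U)"
  show "openin X (\<Inter>\<U>)"
    unfolding coding_openin[OF f]
  proof (intro conjI ballI)
    show "\<Inter>\<U> \<subseteq> topspace X"
      using \<U> openin_subset by blast
    fix x assume x: "x \<in> \<Inter>\<U>"
    have "\<forall>U\<in>\<U>. \<exists>\<gamma>. agree X f (f x) \<gamma> \<subseteq> U"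
      using \<U> x coding_openin[OF f] by (meson InterE)
    then obtain g where g: "\<And>U. U \<in> \<U> \<Longrightarrow> agree X f (f x) (g U) \<subseteq> U"
      by metis
    obtain \<gamma> where \<gamma>: "\<And>\<alpha>. \<alpha> \<in> g ` \<U> \<Longrightarrow> (\<alpha>, \<gamma>) \<in> \<kappa>"
      using bounded_if_small[OF ordLess_image[of \<U> g]] \<U> by blast
    have "agree X f (f x) \<gamma> \<subseteq> \<Inter>\<U>"
    proof (rule Inter_greatest)
      fix U assume "U \<in> \<U>"
      then show "agree X f (f x) \<gamma> \<subseteq> U"
        using g[of U] agree_antimono[OF \<gamma>, of "g U" X f "f x"] by auto
    qed
    then show "\<exists>\<gamma>. agree X f (f x) \<gamma> \<subseteq> \<Inter>\<U>" ..
  qed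
qed

text \<open>
  The sets \<open>agree\<close> form a base indexed by the binary sequences of length less than \<open>\<kappa>\<close>.
\<close>

lemma coding_imp_weight_le:
  assumes f: "coding X f" and card: "|seqs_lt \<kappa> :: ('k \<rightharpoonup> bool) set| \<le>o \<kappa>"
  shows "weight_le X \<kappa>"
proof -
  define N where "N s = {y \<in> topspace X. s \<subseteq>\<^sub>m Some \<circ> f y}" for s :: "'k \<rightharpoonup> bool"
  have N: "N ((Some \<circ> z) |` underS \<kappa> \<gamma>) = agree X f z \<gamma>" for z \<gamma>
    by (auto simp: N_def agree_def map_le_def dom_def restrict_map_def)
  have "openin X (N s)" if s: "s \<in> seqs_lt \<kappa>" for s
  proof -
    obtain \<gamma> where \<gamma>: "dom s = underS \<kappa> \<gamma>"
      using s by (auto simp: seqs_lt_def seqs_def)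
    have "s = (Some \<circ> (\<lambda>\<alpha>. the (s \<alpha>))) |` underS \<kappa> \<gamma>"
    proof
      fix \<alpha>
      have "\<alpha> \<in> underS \<kappa> \<gamma> \<longleftrightarrow> s \<alpha> \<noteq> None"
        unfolding \<gamma>[symmetric] by (rule domIff)
      then show "s \<alpha> = ((Some \<circ> (\<lambda>\<alpha>. the (s \<alpha>))) |` underS \<kappa> \<gamma>) \<alpha>"
        by (auto simp: restrict_map_def)
    qed
    then show ?thesis
      using N coding_openin_agree[OF f] by metis
  qed
  moreover have "\<exists>B \<in> N ` seqs_lt \<kappa>. x \<in> B \<and> B \<subseteq> U" if U: "openin X U" "x \<in> U" for U x
  proof -
    obtain \<gamma> where \<gamma>: "agree X f (f x) \<gamma> \<subseteq> U"
      using coding_openin[OF f] U by blast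
    have "(Some \<circ> f x) |` underS \<kappa> \<gamma> \<in> seqs_lt \<kappa>"
      by (auto simp: seqs_lt_def seqs_def)
    moreover have "x \<in> topspace X"
      using U openin_subset by blast
    ultimately show ?thesis
      using \<gamma> agree_self[of x X f \<gamma>]
      by (intro bexI[of _ "N ((Some \<circ> f x) |` underS \<kappa> \<gamma>)"] conjI imageI) (simp_all add: N)
  qed
  moreover have "|N ` seqs_lt \<kappa>| \<le>o \<kappa>"
    by (rule ordLeq_image[OF card])
  ultimately show ?thesis
    unfolding weight_le_def by (intro exI[of _ "N ` seqs_lt \<kappa>"]) simp
qed

lemma underS_Int_underS:
  obtains \<gamma> where "underS \<kappa> \<alpha> \<inter> underS \<kappa> \<beta> = underS \<kappa> \<gamma>" "(\<gamma>, \<alpha>) \<in> \<kappa>"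
proof (cases "(\<alpha>, \<beta>) \<in> \<kappa>")
  case True
  then show ?thesis
    using underS_mono[OF True] by (intro that[of \<alpha>]) auto
next
  case False
  then have "(\<beta>, \<alpha>) \<in> \<kappa>"
    using le_total by blast
  then show ?thesis
    using underS_mono[of \<beta> \<alpha>] by (intro that[of \<beta>]) auto
qed

text \<open>
  The tree property for binary sequences: a property \<open>L z \<alpha>\<close> of the sequences \<open>z\<restriction>\<alpha>\<close> that passes to
  initial segments and holds for some sequence of every length holds along some branch.  Levels of
  the binary tree have size less than \<open>\<kappa>\<close> by strong inaccessibility.  The two values are represented by
  two elements of \<open>'k\<close>, because weak compactness speaks of trees of \<open>'k\<close>-valued sequences.
\<close>

lemma weakly_compact_branch:
  assumes wc: "weakly_compact \<kappa>"
    and large_restrict: "\<And>z \<alpha> \<beta>. L z \<alpha> \<Longrightarrow> (\<beta>, \<alpha>) \<in> \<kappa> \<Longrightarrow> L z \<beta>"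
    and large_cong: "\<And>z z' \<alpha> \<beta>. underS \<kappa> \<alpha> = underS \<kappa> \<beta> \<Longrightarrow> (\<And>\<gamma>. \<gamma> \<in> underS \<kappa> \<alpha> \<Longrightarrow> z \<gamma> = z' \<gamma>) \<Longrightarrow>
          L z \<alpha> \<Longrightarrow> L z' \<beta>"
    and large_ex: "\<And>\<alpha>. \<exists>z :: 'k \<Rightarrow> bool. L z \<alpha>"
  obtains z where "\<And>\<alpha>. L z \<alpha>"
proof -
  obtain zero one :: 'k where "zero \<noteq> one"
    using infinite_UNIV by (metis (full_types) UNIV_eq_I finite.simps singletonI)
  define e where "e b = (if b then one else zero)" for b
  have e: "e b = e b' \<longleftrightarrow> b = b'" for b b'
    using \<open>zero \<noteq> one\<close> by (auto simp: e_def)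
  define node where "node z \<alpha> = (Some \<circ> e \<circ> z) |` underS \<kappa> \<alpha>" for z \<alpha>
  have dom_node: "dom (node z \<alpha>) = underS \<kappa> \<alpha>" for z \<alpha>
    by (auto simp: node_def)
  define T where "T = {node z \<alpha> | z \<alpha>. L z \<alpha>}"
  have "seq_tree \<kappa> T"
    unfolding seq_tree_def
  proof (intro conjI subsetI ballI allI)
    fix s assume "s \<in> T"
    then obtain z \<alpha> where s: "s = node z \<alpha>" "L z \<alpha>"
      by (auto simp: T_def)
    then show "s \<in> seqs_lt \<kappa>"
      using dom_node by (auto simp: seqs_lt_def seqs_def)
    fix \<beta>
    obtain \<gamma> where "underS \<kappa> \<alpha> \<inter> underS \<kappa> \<beta> = underS \<kappa> \<gamma>" "(\<gamma>, \<alpha>) \<in> \<kappa>"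
      by (rule underS_Int_underS)
    then have "s |` underS \<kappa> \<beta> = node z \<gamma>" "L z \<gamma>"
      using s large_restrict by (auto simp: node_def Int_commute)
    then show "s |` underS \<kappa> \<beta> \<in> T"
      by (auto simp: T_def)
  qed
  moreover have "T \<inter> seqs \<kappa> \<alpha> \<noteq> {}" for \<alpha>
  proof -
    obtain z where "L z \<alpha>"
      using large_ex by blast
    then have "node z \<alpha> \<in> T \<inter> seqs \<kappa> \<alpha>"
      by (auto simp: T_def seqs_def dom_node)
    then show ?thesis
      by blast
  qed
  moreover have "|T \<inter> seqs \<kappa> \<alpha>| <o \<kappa>" for \<alpha>
  proof (rule ordLess_subset)
    show "|(\<lambda>S. node (\<lambda>\<beta>. \<beta> \<in> S) \<alpha>) ` Pow (underS \<kappa> \<alpha>)| <o \<kappa>"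
      using wc ordLess_underS by (intro ordLess_image) (simp add: weakly_compact_def strongly_inaccessible_def)
    show "T \<inter> seqs \<kappa> \<alpha> \<subseteq> (\<lambda>S. node (\<lambda>\<beta>. \<beta> \<in> S) \<alpha>) ` Pow (underS \<kappa> \<alpha>)"
    proof
      fix s assume "s \<in> T \<inter> seqs \<kappa> \<alpha>"
      then obtain z \<beta> where s: "s = node z \<beta>" "dom s = underS \<kappa> \<alpha>"
        by (auto simp: T_def seqs_def)
      then have "underS \<kappa> \<beta> = underS \<kappa> \<alpha>"
        by (simp add: dom_node)
      then have "s = node (\<lambda>\<beta>. \<beta> \<in> {\<beta> \<in> underS \<kappa> \<alpha>. z \<beta>}) \<alpha>"
        unfolding s(1) node_def by (auto simp: fun_eq_iff restrict_map_def)
      then show "s \<in> (\<lambda>S. node (\<lambda>\<beta>. \<beta> \<in> S) \<alpha>) ` Pow (underS \<kappa> \<alpha>)"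
        by blast
    qed
  qed
  ultimately obtain b where b: "kappa_branch \<kappa> T b"
    using wc unfolding weakly_compact_def by blast
  have "L (\<lambda>\<beta>. b \<beta> = one) \<alpha>" for \<alpha>
  proof -
    have "(Some \<circ> b) |` underS \<kappa> \<alpha> \<in> T"
      using b by (simp add: kappa_branch_def)
    then obtain z \<beta> where zb: "(Some \<circ> b) |` underS \<kappa> \<alpha> = node z \<beta>" "L z \<beta>"
      by (auto simp: T_def)
    have "dom ((Some \<circ> b) |` underS \<kappa> \<alpha>) = underS \<kappa> \<alpha>"
      by auto
    then have dom: "underS \<kappa> \<beta> = underS \<kappa> \<alpha>"
      by (simp add: zb(1) dom_node)
    have "b \<gamma> = e (z \<gamma>)" if "\<gamma> \<in> underS \<kappa> \<beta>" for \<gamma>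
      using fun_cong[OF zb(1), of \<gamma>] that by (simp add: node_def dom)
    then have eq: "z \<gamma> \<longleftrightarrow> b \<gamma> = one" if "\<gamma> \<in> underS \<kappa> \<beta>" for \<gamma>
      using that \<open>zero \<noteq> one\<close> by (simp add: e_def)
    show ?thesis
      using dom eq zb(2) by (rule large_cong)
  qed
  then show ?thesis
    by (rule that)
qed

text \<open>
  Suppose that a cover has no subcover of size less than \<open>\<kappa>\<close>.  The sequences for which the points
  extending them cannot be covered by fewer than \<open>\<kappa>\<close> members form a tree as in the previous lemma; its
  levels are inhabited since \<open>\<kappa>\<close> is regular and levels are small.  A branch through it is
  contradictory: if it is the code of a point, one member of the cover contains a neighbourhood of
  this point; if not, by closedness no point extends a sufficiently long initial segment of it.
\<close>

lemma weakly_compact_coding_imp_Lindelof: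
  assumes wc: "weakly_compact \<kappa>" and f: "coding X f" and closed: "closed_image X f"
  shows "kappa_Lindelof \<kappa> X"
  unfolding kappa_Lindelof_def
proof (intro allI impI, elim conjE, rule ccontr)
  fix \<U> assume op: "\<forall>U\<in>\<U>. openin X U" and cover: "\<Union>\<U> = topspace X"
    and no_subcover: "\<nexists>\<V>. \<V> \<subseteq> \<U> \<and> |\<V>| <o \<kappa> \<and> \<Union>\<V> = topspace X"
  define small where "small A \<longleftrightarrow> (\<exists>\<V>\<subseteq>\<U>. |\<V>| <o \<kappa> \<and> A \<subseteq> \<Union>\<V>)" for A
  have small_mono: "small B \<Longrightarrow> A \<subseteq> B \<Longrightarrow> small A" for A B
    unfolding small_def by (meson subset_trans)
  have not_small: "\<not> small (topspace X)"
  proof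
    assume "small (topspace X)"
    then obtain \<V> where "\<V> \<subseteq> \<U>" "|\<V>| <o \<kappa>" "topspace X \<subseteq> \<Union>\<V>"
      unfolding small_def by blast
    moreover have "\<Union>\<V> \<subseteq> topspace X"
      using \<open>\<V> \<subseteq> \<U>\<close> cover by blast
    ultimately have "\<exists>\<V>. \<V> \<subseteq> \<U> \<and> |\<V>| <o \<kappa> \<and> \<Union>\<V> = topspace X"
      by (intro exI[of _ \<V>] conjI subset_antisym)
    with no_subcover show False ..
  qed
  obtain z where z: "\<And>\<alpha>. \<not> small (agree X f z \<alpha>)"
  proof (rule weakly_compact_branch[OF wc, of "\<lambda>z \<alpha>. \<not> small (agree X f z \<alpha>)"])
    show "\<not> small (agree X f z \<beta>)" if "\<not> small (agree X f z \<alpha>)" "(\<beta>, \<alpha>) \<in> \<kappa>" for z \<alpha> \<beta>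
      using that(1) small_mono[OF _ agree_antimono[OF that(2)]] by metis
    show "\<not> small (agree X f z' \<beta>)"
      if "underS \<kappa> \<alpha> = underS \<kappa> \<beta>" "\<And>\<gamma>. \<gamma> \<in> underS \<kappa> \<alpha> \<Longrightarrow> z \<gamma> = z' \<gamma>" "\<not> small (agree X f z \<alpha>)"
      for z z' \<alpha> \<beta>
    proof -
      have "agree X f z' \<beta> = agree X f z \<alpha>"
        using that(1,2) by (auto simp: agree_def)
      then show ?thesis
        using that(3) by simp
    qed
    show "\<exists>z. \<not> small (agree X f z \<alpha>)" for \<alpha>
    proof (rule ccontr)
      assume "\<nexists>z. \<not> small (agree X f z \<alpha>)"
      then have "small (agree X f (\<lambda>\<beta>. \<beta> \<in> S) \<alpha>)" for S
        by simp
      then have "\<exists>\<V>\<subseteq>\<U>. |\<V>| <o \<kappa> \<and> agree X f (\<lambda>\<beta>. \<beta> \<in> S) \<alpha> \<subseteq> \<Union>\<V>" for S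
        unfolding small_def .
      then obtain \<V> where \<V>: "\<And>S. \<V> S \<subseteq> \<U>" "\<And>S. |\<V> S| <o \<kappa>"
          "\<And>S. agree X f (\<lambda>\<beta>. \<beta> \<in> S) \<alpha> \<subseteq> \<Union>(\<V> S)"
        by metis
      have "|\<Union>S\<in>Pow (underS \<kappa> \<alpha>). \<V> S| <o \<kappa>"
        using wc ordLess_underS \<V>(2)
        by (intro ordLess_UNION) (simp_all add: weakly_compact_def strongly_inaccessible_def)
      moreover have "topspace X \<subseteq> \<Union>(\<Union>S\<in>Pow (underS \<kappa> \<alpha>). \<V> S)"
      proof
        fix x assume x: "x \<in> topspace X"
        let ?S = "{\<beta> \<in> underS \<kappa> \<alpha>. f x \<beta>}"
        have "x \<in> agree X f (\<lambda>\<beta>. \<beta> \<in> ?S) \<alpha>"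
          using x by (simp add: agree_def)
        then have "x \<in> \<Union>(\<V> ?S)"
          using \<V>(3)[of ?S] by (rule subsetD[rotated])
        moreover have "?S \<in> Pow (underS \<kappa> \<alpha>)"
          by blast
        ultimately show "x \<in> \<Union>(\<Union>S\<in>Pow (underS \<kappa> \<alpha>). \<V> S)"
          by blast
      qed
      moreover have "(\<Union>S\<in>Pow (underS \<kappa> \<alpha>). \<V> S) \<subseteq> \<U>"
        using \<V>(1) by blast
      ultimately have "small (topspace X)"
        unfolding small_def by (intro exI[of _ "\<Union>S\<in>Pow (underS \<kappa> \<alpha>). \<V> S"] conjI)
      with not_small show False ..
    qed
  qed (rule that; blast)
  show False
  proof (cases "z \<in> f ` topspace X")
    case True
    then obtain x where x: "x \<in> topspace X" "z = f x"
      by blast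
    then obtain U where U: "U \<in> \<U>" "x \<in> U"
      using cover by blast
    then obtain \<gamma> where "agree X f z \<gamma> \<subseteq> U"
      using op coding_openin[OF f, of U] x by blast
    then have "small (agree X f z \<gamma>)"
      unfolding small_def using U(1) ordLess_finite[of "{U}"] by (intro exI[of _ "{U}"]) simp
    then show False
      using z by blast
  next
    case False
    then obtain \<gamma> where "agree X f z \<gamma> = {}"
      using closed unfolding closed_image_def by blast
    then have "small (agree X f z \<gamma>)"
      unfolding small_def using ordLess_finite[of "{}"] by (intro exI[of _ "{}"]) simp
    then show False
      using z by blast
  qed
qed

end

section \<open>The equivalences\<close>

theorem theorem3p20:
  fixes \<kappa> :: "'k rel" and X :: "'a topology"
  assumes "card_order \<kappa>" and "natLeq <o \<kappa>" and "regularCard \<kappa>"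
    and "|seqs_lt \<kappa> :: ('k \<rightharpoonup> bool) set| =o \<kappa>"
    and "Deg_eq TYPE('g::linordered_ab_group_add) \<kappa>"
    and "regular_space X" and "Hausdorff_space X"
  shows "let a = kappa_Lindelof \<kappa> X \<and> kappa_additive \<kappa> X \<and> weight_le X \<kappa>;
             b = kappa_Lindelof \<kappa> X \<and> G_metrizable TYPE('g) X;
             c = kappa_Lindelof \<kappa> X \<and> G_Polish \<kappa> TYPE('g) X;
             d = kappa_Lindelof \<kappa> X \<and> kappa_additive \<kappa> X \<and> fSC_space \<kappa> X;
             e = (\<exists>C. closedin (bounded_topology \<kappa>) C \<and>
                      X homeomorphic_space subtopology (bounded_topology \<kappa>) C)
         in (a \<longleftrightarrow> b) \<and> (b \<longleftrightarrow> c) \<and> (c \<longleftrightarrow> d) \<and> (weakly_compact \<kappa> \<longrightarrow> (d \<longleftrightarrow> e))"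
proof -
  interpret uncountable_regular_cardinal \<kappa>
    using assms(1-3) by unfold_locales
  define a where "a \<longleftrightarrow> kappa_Lindelof \<kappa> X \<and> kappa_additive \<kappa> X \<and> weight_le X \<kappa>"
  define b where "b \<longleftrightarrow> kappa_Lindelof \<kappa> X \<and> G_metrizable TYPE('g) X"
  define c where "c \<longleftrightarrow> kappa_Lindelof \<kappa> X \<and> G_Polish \<kappa> TYPE('g) X"
  define d where "d \<longleftrightarrow> kappa_Lindelof \<kappa> X \<and> kappa_additive \<kappa> X \<and> fSC_space \<kappa> X"
  define e where "e \<longleftrightarrow> (\<exists>C. closedin (bounded_topology \<kappa>) C \<and>
      X homeomorphic_space subtopology (bounded_topology \<kappa>) C)"
  have coding: "\<exists>f. coding X f \<and> closed_image X f" if a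
  proof -
    obtain f where "coding X f"
      using coding_ex assms(6,7) \<open>a\<close> unfolding a_def by blast
    then show ?thesis
      using Lindelof_imp_closed_image \<open>a\<close> unfolding a_def by blast
  qed
  have "a \<Longrightarrow> c"
    using coding coding_imp_G_Polish[OF assms(5)] unfolding a_def c_def by blast
  moreover have "c \<Longrightarrow> b"
    unfolding b_def c_def G_Polish_def G_metrizable_def by blast
  moreover have "b \<Longrightarrow> a"
    using G_metrizable_imp_additive[OF assms(5)] Lindelof_G_metrizable_imp_weight_le[OF assms(5)]
    unfolding a_def b_def by blast
  moreover have "a \<Longrightarrow> d"
    using Lindelof_additive_imp_winning_strategy assms(6) unfolding a_def d_def fSC_space_def by blast
  moreover have "d \<Longrightarrow> a"
    unfolding a_def d_def fSC_space_def by blast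
  moreover have "a \<Longrightarrow> e"
  proof -
    assume a
    then obtain f where f: "coding X f" "closed_image X f"
      using coding by blast
    then have "X homeomorphic_space subtopology (bounded_topology \<kappa>) (f ` topspace X)"
      using coding_iff_homeomorphic_map homeomorphic_map_imp_homeomorphic_space by blast
    then show e
      using f(2) closed_image_iff unfolding e_def by blast
  qed
  moreover have "weakly_compact \<kappa> \<Longrightarrow> e \<Longrightarrow> a"
  proof -
    assume wc: "weakly_compact \<kappa>" and e
    then obtain C f where C: "closedin (bounded_topology \<kappa>) C"
      and f: "homeomorphic_map X (subtopology (bounded_topology \<kappa>) C) f"
      unfolding e_def homeomorphic_space by blast
    have image: "f ` topspace X = C"
      using homeomorphic_imp_surjective_map[OF f] by simp
    have "coding X f" "closed_image X f"
      using f C by (simp_all add: coding_iff_homeomorphic_map closed_image_iff image)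
    then show a
      using weakly_compact_coding_imp_Lindelof[OF wc] coding_imp_additive
        coding_imp_weight_le[OF _ ordIso_imp_ordLeq[OF assms(4)]]
      unfolding a_def by blast
  qed
  ultimately show ?thesis
    unfolding Let_def a_def[symmetric] b_def[symmetric] c_def[symmetric] d_def[symmetric]
      e_def[symmetric] by blast
qed

end
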